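(* Let $n\ge 2$. For $z=(z_1,\ldots,z_n)^T\in\mathbb C^n$, set $$X=|z_1|^2-|z_2|^2,\quad Y=2\operatorname{Im}(\overline{z_1}z_2),\quad Z=2\operatorname{Re}(\overline{z_1}z_2).$$ Define $$f(z)=2e^{-|z|^2}\left\{i e^{-2iY}\sin\bigl(2(X-Z)\bigr)-e^{2iY}\sin\bigl(2(X+Z)\bigr)\right\}$$ and $$g(z)=2e^{-|z|^2}\left\{e^{-2iY}\cos\bigl(2(X+Z)\bigr)+i e^{2iY}\cos\bigl(2(X-Z)\bigr)\right\}.$$ Then $f,g\in\mathcal S(\mathbb C^n)$ are nonradial and satisfy $|f(z)|\le 4e^{-|z|^2}$ and $|g(z)|\le 4e^{-|z|^2}$ for all $z\in\mathbb C^n$. The Toeplitz operators satisfy $$T_fT_g=0,\quad T_f\ne 0,\quad T_g\ne 0\quad\text{on } F^2(\mathbb C^n).$$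
   Context: Let $dV$ be Lebesgue measure on $\mathbb C^n\simeq\mathbb R^{2n}$, $|z|=(\sum_\ell|z_\ell|^2)^{1/2}$, and $d\mu(z)=\pi^{-n}e^{-|z|^2}\,dV(z)$. The Fock space is $F^2(\mathbb C^n)=L^2(\mathbb C^n,d\mu)\cap\operatorname{Hol}(\mathbb C^n)$, where $\operatorname{Hol}(\mathbb C^n)$ is the space of entire functions, with inner product $\langle h,k\rangle=\int_{\mathbb C^n}h\overline{k}\,d\mu$. Let $P:L^2(\mathbb C^n,d\mu)\to F^2(\mathbb C^n)$ be the orthogonal projection. For a bounded measurable $\varphi:\mathbb C^n\to\mathbb C$, the Toeplitz operator $T_\varphi$ is the bounded operator on $F^2(\mathbb C^n)$ given by $T_\varphi h=P(\varphi h)$. A measurable function on $\mathbb C^n$ is radial if, up to equality almost everywhere, it depends only on $|z|$; nonradial means not radial. The Schwartz class $\mathcal S(\mathbb C^n)$ consists of all $u\in C^\infty(\mathbb C^n)$ (smooth in the real sense) such that $\sup_{x\in\mathbb R^{2n}}|x^\alpha\partial_x^\beta u(x)|<\infty$ for all multi-indices $\alpha,\beta\in\mathbb N_0^{2n}$, where $\mathbb C^n$ is identified with $\mathbb R^{2n}$ through $x=(\operatorname{Re}z_1,\operatorname{Im}z_1,\ldots,\operatorname{Re}z_n,\operatorname{Im}z_n)^T$. *)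

theory Defs
  imports "HOL-Analysis.Analysis"
begin

text \<open>
  \<open>\<complex>\<^sup>n\<close> is \<^typ>\<open>complex^'n\<close> with \<open>n = CARD('n)\<close>. Its library norm is the Euclidean norm
  \<open>|z|\<close>, and the elements of \<open>Basis\<close> are the unit vectors \<open>axis k 1\<close> and
  \<open>axis k \<i>\<close>, so that the real coordinates \<open>x \<bullet> e\<close> (\<open>e \<in> Basis\<close>) are
  \<open>Re (x $ k)\<close> and \<open>Im (x $ k)\<close>.
\<close>

section \<open>Fock space and Toeplitz operators\<close>

definition gauss_measure :: "(complex^'n) measure" where
  "gauss_measure =
     density lborel (\<lambda>z. ennreal (exp (- (norm z)\<^sup>2) / pi ^ CARD('n)))"

text \<open>Elements of \<open>L\<^sup>2\<close> are represented by Borel functions, not by equivalence classes.\<close>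

definition gauss_L2 :: "(complex^'n \<Rightarrow> complex) set" where
  "gauss_L2 = {u. u \<in> borel_measurable gauss_measure \<and>
                  integrable gauss_measure (\<lambda>z. (cmod (u z))\<^sup>2)}"

definition gauss_inner :: "(complex^'n \<Rightarrow> complex) \<Rightarrow> (complex^'n \<Rightarrow> complex) \<Rightarrow> complex" where
  "gauss_inner h k = (LINT z|gauss_measure. h z * cnj (k z))"

text \<open>Entire functions of several variables: the real Frechet derivative exists at
  every point and is complex linear.\<close>

definition entire :: "(complex^'n \<Rightarrow> complex) \<Rightarrow> bool" where
  "entire h \<longleftrightarrow>
     (\<forall>z. \<exists>D. (h has_derivative D) (at z) \<and> (\<forall>c v. D (c *s v) = c * D v))"

definition fock_space :: "(complex^'n \<Rightarrow> complex) set" where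
  "fock_space = gauss_L2 \<inter> {h. entire h}"

text \<open>Entire functions that agree almost everywhere are equal, so the projection of (the class
  of) \<open>u\<close> is a unique function.\<close>

definition fock_proj :: "(complex^'n \<Rightarrow> complex) \<Rightarrow> (complex^'n \<Rightarrow> complex)" where
  "fock_proj u =
     (THE h. h \<in> fock_space \<and> (\<forall>k\<in>fock_space. gauss_inner (\<lambda>z. u z - h z) k = 0))"

text \<open>Meaningful for bounded measurable \<open>\<phi>\<close> and \<open>h \<in> fock_space\<close>, when
  \<open>\<phi> h \<in> gauss_L2\<close>.\<close>

definition toeplitz ::
    "(complex^'n \<Rightarrow> complex) \<Rightarrow> (complex^'n \<Rightarrow> complex) \<Rightarrow> (complex^'n \<Rightarrow> complex)" where
  "toeplitz \<phi> h = fock_proj (\<lambda>z. \<phi> z * h z)"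

section \<open>Radial functions and the Schwartz class\<close>

definition radial :: "(complex^'n \<Rightarrow> complex) \<Rightarrow> bool" where
  "radial u \<longleftrightarrow> (\<exists>r. AE z in lborel. u z = r (norm z))"

definition partial :: "'a::euclidean_space \<Rightarrow> ('a \<Rightarrow> complex) \<Rightarrow> 'a \<Rightarrow> complex" where
  "partial e u x = vector_derivative (\<lambda>t::real. u (x + t *\<^sub>R e)) (at 0)"

text \<open>Iterated partial derivatives along a list of coordinate directions. For a smooth function
  the order is immaterial and \<open>\<partial>\<^sup>\<beta>\<close> is obtained from any list that contains
  each \<open>e \<in> Basis\<close> exactly \<open>\<beta> e\<close> times.\<close>

definition partials :: "'a::euclidean_space list \<Rightarrow> ('a \<Rightarrow> complex) \<Rightarrow> 'a \<Rightarrow> complex" where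
  "partials es u = foldr partial es u"

definition smooth :: "('a::euclidean_space \<Rightarrow> complex) \<Rightarrow> bool" where
  "smooth u \<longleftrightarrow>
     (\<forall>es. set es \<subseteq> Basis \<longrightarrow>
        continuous_on UNIV (partials es u) \<and>
        (\<forall>e\<in>Basis. \<forall>x. (\<lambda>t::real. partials es u (x + t *\<^sub>R e)) differentiable (at 0)))"

definition schwartz :: "('a::euclidean_space \<Rightarrow> complex) set" where
  "schwartz = {u. smooth u \<and>
     (\<forall>(\<alpha> :: 'a \<Rightarrow> nat) es. set es \<subseteq> Basis \<longrightarrow>
        bounded (range (\<lambda>x. (\<Prod>e\<in>Basis. (x \<bullet> e) ^ \<alpha> e) *\<^sub>R partials es u x)))}"

section \<open>The symbols\<close>

text \<open>The finite type \<^typ>\<open>'n\<close> carries no distinguished enumeration, so the first and second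
  coordinates are given by indices \<open>i\<close> and \<open>j\<close>, to be taken distinct.\<close>

definition coord_X :: "'n::finite \<Rightarrow> 'n \<Rightarrow> complex^'n \<Rightarrow> real" where
  "coord_X i j z = (cmod (z $ i))\<^sup>2 - (cmod (z $ j))\<^sup>2"

definition coord_Y :: "'n::finite \<Rightarrow> 'n \<Rightarrow> complex^'n \<Rightarrow> real" where
  "coord_Y i j z = 2 * Im (cnj (z $ i) * z $ j)"

definition coord_Z :: "'n::finite \<Rightarrow> 'n \<Rightarrow> complex^'n \<Rightarrow> real" where
  "coord_Z i j z = 2 * Re (cnj (z $ i) * z $ j)"

definition symbol_f :: "'n::finite \<Rightarrow> 'n \<Rightarrow> complex^'n \<Rightarrow> complex" where
  "symbol_f i j z =
     (let X = coord_X i j z; Y = coord_Y i j z; Z = coord_Z i j z in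
      2 * complex_of_real (exp (- (norm z)\<^sup>2)) *
        (\<i> * exp (- 2 * \<i> * complex_of_real Y) * complex_of_real (sin (2 * (X - Z)))
           - exp (2 * \<i> * complex_of_real Y) * complex_of_real (sin (2 * (X + Z)))))"

definition symbol_g :: "'n::finite \<Rightarrow> 'n \<Rightarrow> complex^'n \<Rightarrow> complex" where
  "symbol_g i j z =
     (let X = coord_X i j z; Y = coord_Y i j z; Z = coord_Z i j z in
      2 * complex_of_real (exp (- (norm z)\<^sup>2)) *
        (exp (- 2 * \<i> * complex_of_real Y) * complex_of_real (cos (2 * (X + Z)))
           + \<i> * exp (2 * \<i> * complex_of_real Y) * complex_of_real (cos (2 * (X - Z)))))"

end

theory Submission
  imports Defs "HOL-Complex_Analysis.Complex_Analysis" "HOL-Probability.Distributions"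
begin

text \<open>
  Both symbols are combinations of four functions of the form
  \<open>exp (-\<bar>z\<bar>\<^sup>2 + \<i> (x X + y Y + w Z))\<close> with \<open>x, y, w \<in> {2, -2}\<close>. The exponent is
  \<open>- \<langle>A z, z\<rangle>\<close> with \<open>A = I - \<i> H\<close>, where \<open>H\<close> is Hermitian, vanishes outside the
  plane of the coordinates \<open>i, j\<close>, and is \<open>x \<sigma>\<^sub>1 + y \<sigma>\<^sub>2 + w \<sigma>\<^sub>3\<close> on it for three
  anticommuting Pauli matrices. A Gaussian integration gives the Toeplitz operator of such a
  symbol: it is the composition operator
  \<open>h \<mapsto> det (I + A)\<^sup>-\<^sup>1 h \<circ> (I + A)\<^sup>-\<^sup>1\<close>. Since \<open>H\<^sup>2 = 12\<close> on the plane,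
  \<open>(I + A)\<^sup>-\<^sup>1 = (2 + \<i> H) / 16\<close> there, which is one quarter of a Hurwitz unit
  \<open>(1 \<plusminus> \<^bold>i \<plusminus> \<^bold>j \<plusminus> \<^bold>k) / 2\<close>; on the other coordinates it is multiplication by
  \<open>1/2\<close>. All the determinants agree.

  Composing composition operators multiplies the quaternions. So \<open>T_f T_g\<close> is, up to a
  constant, the image of a product of two elements of the complex group algebra of the binary
  tetrahedral group, and this product of two nonzero elements is zero: the sixteen products of
  Hurwitz units cancel (lemma \<open>toeplitz_f_toeplitz_g\<close>). On the other hand \<open>T_f\<close> does
  not kill the coordinate function \<open>z\<^sub>i\<close>, and \<open>T_g\<close> does not kill the constants.

  What needs analysis is the formula for the Toeplitz operator. As an identity of integrals
  against \<open>h\<close> and the conjugate of \<open>q\<close>, both in the Fock space, it is invariant under unitary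
  changes of variables, so \<open>H\<close> may be taken diagonal. Lemma
  \<open>gaussian_diag_identity\<close> then proves it by analytic continuation: the substitution
  \<open>z\<^sub>k \<mapsto> c\<^sub>k z\<^sub>k\<close> leaves the integral unchanged, and after \<open>c\<^sub>k\<close> and its conjugate are
  replaced by independent complex parameters the integral is still constant; for suitable values
  of the parameters it is the integral on the other side of the formula. The continuation needs
  locally uniform domination, which comes from the pointwise growth bound of Fock space functions
  (\<open>fock_growth\<close>), and the invariance of Lebesgue measure under linear isometries
  (\<open>distr_lborel_isometry\<close>).

  The Schwartz property holds because linear combinations of polynomials times such Gaussians are
  stable under differentiation; the symbols are not radial because they take different values at
  two points related by a unitary map.
\<close>

unbundle no fps_syntax

section \<open>Holomorphic parameter integrals\<close>

text \<open>
  The Cauchy estimate turns the bound \<open>g\<close> on the integrand into a bound on its difference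
  quotients in the parameter, so dominated convergence allows differentiation under the integral.
\<close>

lemma holomorphic_on_lebesgue_integral:
  fixes F :: "complex \<Rightarrow> 'a \<Rightarrow> complex"
  assumes S: "open S"
    and meas: "\<And>z. z \<in> S \<Longrightarrow> F z \<in> borel_measurable M"
    and hol: "\<And>x. x \<in> space M \<Longrightarrow> (\<lambda>z. F z x) holomorphic_on S"
    and bound: "\<And>z x. z \<in> S \<Longrightarrow> x \<in> space M \<Longrightarrow> cmod (F z x) \<le> g x"
    and g: "integrable M g"
  shows "(\<lambda>z. \<integral>x. F z x \<partial>M) holomorphic_on S"
proof (rule holomorphic_onI)
  fix z0 assume z0: "z0 \<in> S"
  obtain e where e: "e > 0" "ball z0 e \<subseteq> S"
    using S z0 by (meson open_contains_ball)
  define r where "r = e / 3"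
  have r: "r > 0" using e by (simp add: r_def)
  have sub: "cball w r \<subseteq> S" if "w \<in> ball z0 r" for w
  proof
    fix v assume "v \<in> cball w r"
    then have "dist z0 v < e" using that dist_triangle[of z0 v w] r by (auto simp: r_def)
    then show "v \<in> S" using e by auto
  qed
  have int: "integrable M (F z)" if "z \<in> S" for z
    by (rule Bochner_Integration.integrable_bound[OF g meas[OF that]])
      (use bound[OF that] in \<open>auto intro!: AE_I2 order_trans[OF bound[OF that]]\<close>)
  define D where "D x = deriv (\<lambda>z. F z x) z0" for x
  have lip: "cmod (F w x - F z0 x) \<le> g x / r * cmod (w - z0)"
    if w: "w \<in> ball z0 r" and x: "x \<in> space M" for w x
  proof (rule field_differentiable_bound[where S = "ball z0 r" and f' = "deriv (\<lambda>z. F z x)"])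
    fix v assume v: "v \<in> ball z0 r"
    have vS: "v \<in> S" using sub[OF v] r by auto
    show "((\<lambda>z. F z x) has_field_derivative deriv (\<lambda>z. F z x) v) (at v within ball z0 r)"
      using holomorphic_derivI[OF hol[OF x] S vS] by (rule DERIV_subset) auto
    have "cmod ((deriv ^^ 1) (\<lambda>z. F z x) v) \<le> fact 1 * g x / r ^ 1"
    proof (rule Cauchy_inequality[OF _ _ r])
      show "(\<lambda>z. F z x) holomorphic_on ball v r"
        using hol[OF x] sub[OF v] ball_subset_cball[of v r] by (meson holomorphic_on_subset order_trans)
      show "continuous_on (cball v r) (\<lambda>z. F z x)"
        using holomorphic_on_imp_continuous_on[OF hol[OF x]] sub[OF v] by (rule continuous_on_subset)
      fix y assume "cmod (v - y) = r"
      then have "y \<in> cball v r" by (simp add: dist_norm)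
      then show "cmod (F y x) \<le> g x" using sub[OF v] bound x by blast
    qed
    then show "cmod (deriv (\<lambda>z. F z x) v) \<le> g x / r" by simp
  qed (use w r in auto)
  have "((\<lambda>z. \<integral>x. F z x \<partial>M) has_field_derivative (\<integral>x. D x \<partial>M)) (at z0 within ball z0 r)"
    unfolding has_field_derivative_iff tendsto_at_iff_sequentially comp_def
  proof (intro allI impI)
    fix X :: "nat \<Rightarrow> complex"
    assume XS: "\<forall>i. X i \<in> ball z0 r - {z0}" and lim: "X \<longlonglongrightarrow> z0"
    let ?q = "\<lambda>i x. (F (X i) x - F z0 x) / (X i - z0)"
    have XS': "X i \<in> S" for i using XS sub[of "X i"] r by force
    have q_meas: "?q i \<in> borel_measurable M" for i
      using meas[OF XS'[of i]] meas[OF z0] by measurable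
    have q_lim: "(\<lambda>i. ?q i x) \<longlonglongrightarrow> D x" if x: "x \<in> space M" for x
    proof -
      have "((\<lambda>z. F z x) has_field_derivative D x) (at z0 within ball z0 r)"
        unfolding D_def using holomorphic_derivI[OF hol[OF x] S z0] by (rule DERIV_subset) auto
      then show ?thesis
        unfolding has_field_derivative_iff tendsto_at_iff_sequentially comp_def using XS lim by blast
    qed
    have "(\<lambda>i. \<integral>x. ?q i x \<partial>M) \<longlonglongrightarrow> (\<integral>x. D x \<partial>M)"
    proof (rule integral_dominated_convergence[where w = "\<lambda>x. g x / r"])
      show "D \<in> borel_measurable M"
        by (rule borel_measurable_LIMSEQ_metric[OF q_meas q_lim])
      show "integrable M (\<lambda>x. g x / r)" using g by simp
      show "AE x in M. (\<lambda>i. ?q i x) \<longlonglongrightarrow> D x" using q_lim by (auto intro!: AE_I2)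
      show "AE x in M. cmod (?q i x) \<le> g x / r" for i
      proof (rule AE_I2)
        fix x assume x: "x \<in> space M"
        have "X i \<in> ball z0 r" "X i \<noteq> z0" using XS by auto
        then show "cmod (?q i x) \<le> g x / r"
          using lip[OF _ x, of "X i"] by (simp add: norm_divide divide_le_eq)
      qed
    qed (rule q_meas)
    moreover have "(\<integral>x. ?q i x \<partial>M) = ((\<integral>x. F (X i) x \<partial>M) - (\<integral>x. F z0 x \<partial>M)) / (X i - z0)" for i
      using int[OF XS'[of i]] int[OF z0] by simp
    ultimately show "(\<lambda>i. ((\<integral>x. F (X i) x \<partial>M) - (\<integral>x. F z0 x \<partial>M)) / (X i - z0)) \<longlonglongrightarrow> (\<integral>x. D x \<partial>M)"
      by (simp only:)
  qed
  then have "((\<lambda>z. \<integral>x. F z x \<partial>M) has_field_derivative (\<integral>x. D x \<partial>M)) (at z0)"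
    using r by (simp add: at_within_open[of z0 "ball z0 r"])
  then show "(\<lambda>z. \<integral>x. F z x \<partial>M) field_differentiable at z0 within S"
    using field_differentiable_at_within field_differentiable_def by blast
qed

section \<open>Gaussian integrals and isometries of Lebesgue measure\<close>

lemma integrable_gaussian:
  assumes "\<delta> > 0"
  shows "integrable lborel (\<lambda>z::'a::euclidean_space. exp (- \<delta> * (norm z)\<^sup>2))"
proof -
  have real: "integrable lborel (\<lambda>x::real. exp (- \<delta> * x\<^sup>2))"
  proof -
    define \<sigma> where "\<sigma> = sqrt (1 / (2 * \<delta>))"
    have \<sigma>: "\<sigma> > 0" "2 * \<sigma>\<^sup>2 = 1 / \<delta>" using assms by (auto simp: \<sigma>_def)
    have "integrable lborel (\<lambda>x. sqrt (2 * pi * \<sigma>\<^sup>2) * normal_density 0 \<sigma> x)"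
      using integrable_normal_moment[of \<sigma> 0 0] \<sigma> by simp
    also have "(\<lambda>x. sqrt (2 * pi * \<sigma>\<^sup>2) * normal_density 0 \<sigma> x) = (\<lambda>x. exp (- \<delta> * x\<^sup>2))"
      using \<sigma> assms by (auto simp: normal_density_def fun_eq_iff)
    finally show ?thesis .
  qed
  have eq: "exp (- \<delta> * (norm z)\<^sup>2) = (\<Prod>b\<in>Basis. exp (- \<delta> * (z \<bullet> b)\<^sup>2))" for z :: 'a
    by (simp add: exp_sum[symmetric] norm_eq_sqrt_inner euclidean_inner[of z z] sum_nonneg
        sum_distrib_left power2_eq_square)
  have "(\<integral>\<^sup>+z. ennreal (exp (- \<delta> * (norm z)\<^sup>2)) \<partial>(lborel :: 'a measure))
      = (\<integral>\<^sup>+z. (\<Prod>b\<in>Basis. ennreal (exp (- \<delta> * (z \<bullet> b)\<^sup>2))) \<partial>(lborel :: 'a measure))"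
    by (simp only: eq prod_ennreal[OF exp_ge_zero])
  also have "\<dots> = (\<Prod>b\<in>(Basis :: 'a set). \<integral>\<^sup>+x. ennreal (exp (- \<delta> * x\<^sup>2)) \<partial>lborel)"
    by (rule nn_integral_lborel_prod) auto
  also have "\<dots> < \<infinity>"
  proof -
    have "(\<integral>\<^sup>+x. ennreal (exp (- \<delta> * x\<^sup>2)) \<partial>lborel) < \<infinity>"
      using real unfolding integrable_iff_bounded by simp
    then show ?thesis by (simp add: power_less_top_ennreal)
  qed
  finally show ?thesis by (auto simp: integrable_iff_bounded)
qed

text \<open>
  Completing the square absorbs the linear term into half of the quadratic decay.
\<close>

lemma integrable_gaussian_linear:
  assumes "\<delta> > 0"
  shows "integrable lborel (\<lambda>z::'a::euclidean_space. exp (C * norm z - \<delta> * (norm z)\<^sup>2))"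
proof (rule Bochner_Integration.integrable_bound)
  show "integrable lborel (\<lambda>z::'a. exp (C\<^sup>2 / (2 * \<delta>)) * exp (- (\<delta> / 2) * (norm z)\<^sup>2))"
    using integrable_gaussian[of "\<delta> / 2", where 'a = 'a] assms by simp
  have "C * t - \<delta> * t\<^sup>2 \<le> C\<^sup>2 / (2 * \<delta>) - \<delta> / 2 * t\<^sup>2" for t
  proof -
    have "0 \<le> (C - \<delta> * t)\<^sup>2 / (2 * \<delta>)" using assms by simp
    also have "\<dots> = C\<^sup>2 / (2 * \<delta>) - \<delta> / 2 * t\<^sup>2 - (C * t - \<delta> * t\<^sup>2)"
      using assms by (simp add: field_simps power2_eq_square)
    finally show ?thesis by simp
  qed
  from this[of "norm _"] show "AE z::'a in lborel. norm (exp (C * norm z - \<delta> * (norm z)\<^sup>2))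
      \<le> norm (exp (C\<^sup>2 / (2 * \<delta>)) * exp (- (\<delta> / 2) * (norm z)\<^sup>2))"
    by (auto simp flip: exp_add)
qed measurable

lemma nn_integral_lborel_plus:
  fixes g :: "'a::euclidean_space \<Rightarrow> ennreal"
  assumes [measurable]: "g \<in> borel_measurable borel"
  shows "(\<integral>\<^sup>+x. g (c + x) \<partial>lborel) = (\<integral>\<^sup>+x. g x \<partial>lborel)"
  by (subst (2) lborel_distr_plus[of c, symmetric]) (simp add: nn_integral_distr)

lemma linear_borel_measurable:
  fixes U :: "'a::euclidean_space \<Rightarrow> 'b::euclidean_space"
  assumes "linear U"
  shows "U \<in> borel_measurable borel"
  using linear_continuous_on[of U UNIV] assms
  by (intro borel_measurable_continuous_onI) (auto simp: linear_conv_bounded_linear)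

text \<open>
  The uniqueness proof for Haar measure, specialised to \<open>A \<mapsto> vol (U\<^sup>-\<^sup>1 A)\<close>. Translating
  inside the double integral of \<open>f (U x) g y\<close> moves \<open>U\<close> from \<open>f\<close> to \<open>g\<close>. When
  \<open>f\<close> is the indicator of the unit ball, which is invariant under \<open>U\<close> and under
  reflection, the two integrals of \<open>f\<close> agree and cancel.
\<close>

lemma distr_lborel_isometry:
  fixes U :: "'a::euclidean_space \<Rightarrow> 'a"
  assumes U: "linear U" and norm: "\<And>x. norm (U x) = norm x"
  shows "distr lborel borel U = lborel"
proof (rule measure_eqI)
  fix A assume "A \<in> sets (distr lborel borel U)"
  then have A[measurable]: "A \<in> sets borel" by simp
  note [measurable] = linear_borel_measurable[OF U]
  have "inj U"
    using U norm by (metis linear_injective_0 norm_eq_zero)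
  then have "surj U" using U by (simp add: linear_injective_imp_surjective)
  define f g :: "'a \<Rightarrow> ennreal" where "f = indicator (ball 0 1)" and "g = indicator A"
  have [measurable]: "f \<in> borel_measurable borel" "g \<in> borel_measurable borel"
    unfolding f_def g_def by (rule borel_measurable_indicator; simp)+
  have f: "f (U x) = f x" "f (- x) = f x" for x
    by (simp_all add: f_def indicator_def norm)
  define c where "c = (\<integral>\<^sup>+x. f x \<partial>lborel)"
  have c: "c = emeasure lborel (ball 0 1 :: 'a set)" by (simp add: c_def f_def)
  have "c \<noteq> 0" "c \<noteq> \<infinity>"
    using content_ball_pos[of 1 "0::'a"] emeasure_lborel_ball_finite[of "0::'a" 1]
    unfolding c by (auto simp: measure_def)
  have "c * (\<integral>\<^sup>+y. g y \<partial>lborel) = (\<integral>\<^sup>+x. \<integral>\<^sup>+y. f (U x) * g y \<partial>lborel \<partial>lborel)"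
    by (simp add: c_def f nn_integral_cmult nn_integral_multc)
  also have "\<dots> = (\<integral>\<^sup>+x. \<integral>\<^sup>+y. f (U x) * g (U x + y) \<partial>lborel \<partial>lborel)"
    by (simp add: nn_integral_cmult nn_integral_lborel_plus)
  also have "\<dots> = (\<integral>\<^sup>+y. \<integral>\<^sup>+x. f (U x) * g (U x + y) \<partial>lborel \<partial>lborel)"
    by (rule lborel_pair.Fubini'[symmetric]) measurable
  also have "\<dots> = (\<integral>\<^sup>+y. \<integral>\<^sup>+x. f (U x - y) * g (U x) \<partial>lborel \<partial>lborel)"
  proof (rule nn_integral_cong)
    fix y :: 'a
    obtain v where v: "y = U v" using \<open>surj U\<close> by (metis surjD)
    show "(\<integral>\<^sup>+x. f (U x) * g (U x + y) \<partial>lborel) = (\<integral>\<^sup>+x. f (U x - y) * g (U x) \<partial>lborel)"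
      using nn_integral_lborel_plus[of "\<lambda>x. f (U x - y) * g (U x)" v]
      by (simp add: v linear_add[OF U] add.commute)
  qed
  also have "\<dots> = (\<integral>\<^sup>+x. \<integral>\<^sup>+y. f (U x - y) * g (U x) \<partial>lborel \<partial>lborel)"
    by (rule lborel_pair.Fubini') measurable
  also have "\<dots> = (\<integral>\<^sup>+x. c * g (U x) \<partial>lborel)"
  proof (rule nn_integral_cong)
    fix x
    have "(\<integral>\<^sup>+y. f (U x - y) \<partial>lborel) = c"
      using nn_integral_lborel_plus[of "\<lambda>y. f (U x - y)" "U x"] by (simp add: f c_def)
    then show "(\<integral>\<^sup>+y. f (U x - y) * g (U x) \<partial>lborel) = c * g (U x)"
      by (simp add: nn_integral_multc)
  qed
  also have "\<dots> = c * (\<integral>\<^sup>+x. g (U x) \<partial>lborel)" by (simp add: nn_integral_cmult)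
  finally have "(\<integral>\<^sup>+y. g y \<partial>lborel) = (\<integral>\<^sup>+x. g (U x) \<partial>lborel)"
    using \<open>c \<noteq> 0\<close> \<open>c \<noteq> \<infinity>\<close> by (simp add: ennreal_mult_cancel_left)
  also have "\<dots> = (\<integral>\<^sup>+x. g x \<partial>distr lborel borel U)" by (simp add: nn_integral_distr)
  finally show "emeasure (distr lborel borel U) A = emeasure lborel A"
    by (simp add: g_def)
qed simp

lemma integral_lborel_isometry:
  fixes U :: "'a::euclidean_space \<Rightarrow> 'a" and F :: "'a \<Rightarrow> 'b::{banach, second_countable_topology}"
  assumes "linear U" "\<And>x. norm (U x) = norm x" "F \<in> borel_measurable borel"
  shows "(\<integral>x. F (U x) \<partial>lborel) = (\<integral>x. F x \<partial>lborel)"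
  using integral_distr[of U lborel borel F] distr_lborel_isometry[OF assms(1,2)]
    linear_borel_measurable[OF assms(1)] assms(3) by simp

lemma continuous_AE_zero:
  fixes f :: "'a::euclidean_space \<Rightarrow> 'b::real_normed_vector"
  assumes c: "continuous_on UNIV f" and ae: "AE x in lborel. f x = 0"
  shows "f x = 0"
proof (rule ccontr)
  assume "f x \<noteq> 0"
  have "open {x. f x \<noteq> 0}" using c by (simp add: open_Collect_neq)
  moreover
  have "{x \<in> space lborel. f x \<noteq> 0} \<in> null_sets lborel"
    using ae \<open>open {x. f x \<noteq> 0}\<close> by (subst AE_iff_null[symmetric]) auto
  then have "negligible {x. f x \<noteq> 0}"
    by (simp add: negligible_iff_null_sets null_sets_completionI)
  ultimately show False using open_not_negligible \<open>f x \<noteq> 0\<close> by blast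
qed

section \<open>Diagonal maps of complex coordinate space\<close>

definition cdiag :: "('n \<Rightarrow> complex) \<Rightarrow> complex^'n \<Rightarrow> complex^'n" where
  "cdiag c z = (\<chi> k. c k * z $ k)"

lemma cdiag_nth [simp]: "cdiag c z $ k = c k * z $ k"
  by (simp add: cdiag_def)

lemma linear_cdiag: "linear (cdiag c)"
  by (rule linearI) (auto simp: vec_eq_iff algebra_simps)

lemma norm_vec_sq: "(norm z)\<^sup>2 = (\<Sum>k\<in>UNIV. (cmod (z $ k))\<^sup>2)" for z :: "complex^'n"
  by (simp add: norm_vec_def L2_set_def sum_nonneg)

lemma norm_cdiag_unimodular:
  assumes "\<And>k. cmod (u k) = 1"
  shows "norm (cdiag u z) = norm z"
  by (simp add: norm_vec_def norm_mult assms)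

lemma norm_cdiag_le:
  assumes "\<And>k. cmod (c k) \<le> R"
  shows "norm (cdiag c z) \<le> R * norm z"
proof -
  have R: "R \<ge> 0" using assms order_trans norm_ge_zero by blast
  have "(norm (cdiag c z))\<^sup>2 \<le> (\<Sum>k\<in>UNIV. R\<^sup>2 * (cmod (z $ k))\<^sup>2)"
    unfolding norm_vec_sq
    by (intro sum_mono) (simp add: norm_mult power_mult_distrib mult_right_mono power_mono assms)
  also have "\<dots> = (R * norm z)\<^sup>2"
    by (simp add: norm_vec_sq power_mult_distrib sum_distrib_left)
  finally show ?thesis using R by (meson mult_nonneg_nonneg norm_ge_zero power2_le_imp_le)
qed

lemma linear_vector_scalar: "linear (\<lambda>w. c *s w)" for c :: complex
  by (rule linearI) (auto simp: vec_eq_iff algebra_simps)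

lemma norm_vector_scalar: "norm (c *s w) = cmod c * norm w" for w :: "complex^'n"
proof -
  have "(norm (c *s w))\<^sup>2 = (cmod c * norm w)\<^sup>2"
    by (simp add: norm_vec_sq power_mult_distrib norm_mult sum_distrib_left)
  then show ?thesis by (simp add: power2_eq_iff_nonneg)
qed

text \<open>
  Multiplication by \<open>c\<^sub>k\<close> is a real dilation by \<open>\<bar>c\<^sub>k\<bar>\<close> in both real coordinates of
  \<open>z\<^sub>k\<close>, hence the square, followed by a rotation, which preserves Lebesgue measure.
\<close>

lemma integral_lborel_cdiag:
  fixes F :: "complex^'n \<Rightarrow> 'b::{banach, second_countable_topology}"
  assumes c: "\<And>k. c k \<noteq> 0" and F[measurable]: "F \<in> borel_measurable borel"
  shows "(\<integral>z. F z \<partial>lborel) = (\<Prod>k\<in>UNIV. (cmod (c k))\<^sup>2) *\<^sub>R (\<integral>z. F (cdiag c z) \<partial>lborel)"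
proof -
  define r where "r k = complex_of_real (cmod (c k))" for k
  define u where "u k = c k / r k" for k
  have cu: "cdiag c z = cdiag r (cdiag u z)" for z
    using c by (simp add: vec_eq_iff u_def r_def)
  define s :: "complex^'n \<Rightarrow> real" where "s e = (\<Sum>k\<in>UNIV. cmod (c k) * cmod (e $ k))" for e
  have s: "s (axis k v) = cmod (c k)" if "v \<in> Basis" for k v
  proof -
    have "s (axis k v) = (\<Sum>l\<in>UNIV. if l = k then cmod (c k) * cmod v else 0)"
      unfolding s_def by (rule sum.cong) (auto simp: axis_def)
    then show ?thesis using that by simp
  qed
  have pos: "s e > 0" if "e \<in> Basis" for e
    using that s c by (auto simp: Basis_vec_def)
  have T: "(\<Sum>e\<in>Basis. (s e * (z \<bullet> e)) *\<^sub>R e) = cdiag r z" for z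
  proof (rule euclidean_eqI)
    fix e :: "complex^'n" assume e: "e \<in> Basis"
    then obtain k v where kv: "e = axis k v" "v \<in> Basis" by (auto simp: Basis_vec_def)
    have "(\<Sum>e\<in>Basis. (s e * (z \<bullet> e)) *\<^sub>R e) \<bullet> e = s e * (z \<bullet> e)"
      using e by (simp add: inner_sum_left inner_Basis if_distrib cong: if_cong)
    also have "\<dots> = cdiag r z \<bullet> e"
      using s[OF kv(2), of k] by (simp add: kv(1) inner_axis r_def inner_complex_def algebra_simps)
    finally show "(\<Sum>e\<in>Basis. (s e * (z \<bullet> e)) *\<^sub>R e) \<bullet> e = cdiag r z \<bullet> e" .
  qed
  have prod: "(\<Prod>e\<in>Basis. \<bar>s e\<bar>) = (\<Prod>k\<in>UNIV. (cmod (c k))\<^sup>2)"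
  proof -
    have "(\<Prod>e\<in>Basis. \<bar>s e\<bar>) = (\<Prod>k\<in>UNIV. \<Prod>e\<in>(\<Union>v\<in>Basis. {axis k v}). \<bar>s e\<bar>)"
      unfolding Basis_vec_def
      by (subst prod.UNION_disjoint) (auto simp: axis_eq_axis nonzero_Basis)
    also have "\<dots> = (\<Prod>k\<in>UNIV. (cmod (c k))\<^sup>2)"
    proof (rule prod.cong)
      fix k :: 'n
      have "(\<Prod>e\<in>(\<Union>v\<in>Basis. {axis k v}). \<bar>s e\<bar>) = (\<Prod>v\<in>(Basis::complex set). \<bar>s (axis k v)\<bar>)"
        unfolding UNION_singleton_eq_range
        by (rule prod.reindex_cong[where l = "axis k"]) (auto simp: inj_on_def axis_eq_axis)
      also have "\<dots> = (\<Prod>v\<in>(Basis::complex set). cmod (c k))"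
        by (rule prod.cong) (auto simp: s)
      also have "\<dots> = (cmod (c k))\<^sup>2" by simp
      finally show "(\<Prod>e\<in>(\<Union>v\<in>Basis. {axis k v}). \<bar>s e\<bar>) = (cmod (c k))\<^sup>2" .
    qed simp
    finally show ?thesis .
  qed
  have [measurable]: "cdiag r \<in> borel_measurable borel"
    by (rule linear_borel_measurable[OF linear_cdiag])
  have "(lborel :: (complex^'n) measure) = density (distr lborel borel (cdiag r)) (\<lambda>_. \<Prod>k\<in>UNIV. (cmod (c k))\<^sup>2)"
  proof -
    have "s e \<noteq> 0" if "e \<in> Basis" for e using pos[OF that] by simp
    from lborel_affine_euclidean[of s 0, OF this] show ?thesis by (simp only: prod T add_0)
  qed
  then have "(\<integral>z. F z \<partial>lborel) = (\<integral>z. F z \<partial>density (distr lborel borel (cdiag r)) (\<lambda>_. \<Prod>k\<in>UNIV. (cmod (c k))\<^sup>2))"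
    by metis
  also have "\<dots> = (\<Prod>k\<in>UNIV. (cmod (c k))\<^sup>2) *\<^sub>R (\<integral>z. F (cdiag r z) \<partial>lborel)"
    by (subst integral_density) (auto simp: integral_distr prod_nonneg)
  also have "(\<integral>z. F (cdiag r z) \<partial>lborel) = (\<integral>z. F (cdiag r (cdiag u z)) \<partial>lborel)"
  proof (rule integral_lborel_isometry[symmetric, OF linear_cdiag])
    show "norm (cdiag u z) = norm z" for z
      by (rule norm_cdiag_unimodular) (use c in \<open>simp add: u_def r_def norm_divide\<close>)
  qed measurable
  finally show ?thesis by (simp add: cu)
qed

section \<open>Entire functions of several variables\<close>

lemma entireI:
  assumes "\<And>z. (h has_derivative D z) (at z)" "\<And>z c v. D z (c *s v) = c * D z v"
  shows "entire h"
  using assms unfolding entire_def by blast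

lemma entire_const: "entire (\<lambda>_. a)"
  by (rule entireI[where D = "\<lambda>_ _. 0"]) auto

lemma entire_nth: "entire (\<lambda>z. z $ k)"
  by (rule entireI[where D = "\<lambda>_ v. v $ k"])
    (auto intro!: bounded_linear_imp_has_derivative)

lemma entire_add: assumes "entire f" "entire g" shows "entire (\<lambda>z. f z + g z)"
proof -
  obtain F where F: "\<And>z. (f has_derivative F z) (at z)" "\<And>z c v. F z (c *s v) = c * F z v"
    using assms(1) unfolding entire_def by metis
  obtain G where G: "\<And>z. (g has_derivative G z) (at z)" "\<And>z c v. G z (c *s v) = c * G z v"
    using assms(2) unfolding entire_def by metis
  show ?thesis
    by (rule entireI[where D = "\<lambda>z v. F z v + G z v"])
      (auto intro!: derivative_intros F(1) G(1) simp: F(2) G(2) algebra_simps)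
qed

lemma entire_cmult: assumes "entire f" shows "entire (\<lambda>z. a * f z)"
proof -
  obtain F where F: "\<And>z. (f has_derivative F z) (at z)" "\<And>z c v. F z (c *s v) = c * F z v"
    using assms(1) unfolding entire_def by metis
  show ?thesis
    by (rule entireI[where D = "\<lambda>z v. a * F z v"])
      (auto intro!: derivative_intros F(1) simp: F(2) algebra_simps)
qed

lemma entire_compose_linear:
  fixes h :: "complex^'n \<Rightarrow> complex"
  assumes "entire h" and A: "linear A" "\<And>c v. A (c *s v) = c *s A v"
  shows "entire (\<lambda>z. h (A z))"
proof -
  obtain F where F: "\<And>z. (h has_derivative F z) (at z)" "\<And>z c v. F z (c *s v) = c * F z v"
    using assms(1) unfolding entire_def by metis
  have "(A has_derivative A) (at z)" for z
    using A(1) by (intro bounded_linear_imp_has_derivative) (simp add: linear_conv_bounded_linear)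
  then show ?thesis
    by (intro entireI[where D = "\<lambda>z v. F (A z) (A v)"])
      (auto intro: has_derivative_compose[OF _ F(1)] simp: F(2) A(2))
qed

definition vcnj :: "complex^'n \<Rightarrow> complex^'n" where
  "vcnj z = (\<chi> k. cnj (z $ k))"

text \<open>
  Conjugating argument and value preserves entire functions. This turns the factor
  \<open>cnj (q z)\<close> of an inner product into an entire function of the conjugate coordinates.
\<close>

lemma entire_cnj:
  fixes q :: "complex^'n \<Rightarrow> complex"
  assumes "entire q"
  shows "entire (\<lambda>z. cnj (q (vcnj z)))"
proof -
  obtain F where F: "\<And>z. (q has_derivative F z) (at z)" "\<And>z c v. F z (c *s v) = c * F z v"
    using assms(1) unfolding entire_def by metis
  have "linear (vcnj :: complex^'n \<Rightarrow> complex^'n)"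
    by (rule linearI) (auto simp: vec_eq_iff vcnj_def)
  then have V: "(vcnj has_derivative vcnj) (at z)" for z :: "complex^'n"
    by (intro bounded_linear_imp_has_derivative) (simp add: linear_conv_bounded_linear)
  have sc: "vcnj (c *s v) = cnj c *s vcnj v" for c and v :: "complex^'n"
    by (simp add: vec_eq_iff vcnj_def)
  show ?thesis
    by (intro entireI[where D = "\<lambda>z v. cnj (F (vcnj z) (vcnj v))"])
      (auto intro!: has_derivative_cnj has_derivative_compose[OF V F(1)] simp: F(2) sc)
qed

lemma entire_continuous: "entire h \<Longrightarrow> continuous_on UNIV h"
  unfolding entire_def by (meson continuous_at_imp_continuous_on has_derivative_continuous)

lemma entire_measurable: "entire h \<Longrightarrow> h \<in> borel_measurable borel"
  by (simp add: borel_measurable_continuous_onI entire_continuous)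

lemma entire_holomorphic:
  fixes h :: "complex^'n \<Rightarrow> complex"
  assumes h: "entire h" and S: "open S" and \<gamma>: "\<And>k. (\<lambda>s. \<gamma> s k) holomorphic_on S"
  shows "(\<lambda>s. h (\<chi> k. \<gamma> s k)) holomorphic_on S"
proof (rule holomorphic_onI)
  fix s assume s: "s \<in> S"
  obtain F where F: "\<And>z. (h has_derivative F z) (at z)" "\<And>z c v. F z (c *s v) = c * F z v"
    using h unfolding entire_def by metis
  define a where "a k = deriv (\<lambda>s. \<gamma> s k) s" for k
  have "((\<lambda>s. \<chi> k. \<gamma> s k) has_derivative (\<lambda>t. t *s (\<chi> k. a k))) (at s)"
  proof (subst has_derivative_componentwise_within, intro ballI)
    fix e :: "complex^'n" assume "e \<in> Basis"
    then obtain k v where e: "e = axis k v" by (auto simp: Basis_vec_def)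
    have "((\<lambda>s. \<gamma> s k) has_derivative (\<lambda>t. t * a k)) (at s)"
      using holomorphic_derivI[OF \<gamma>[of k] S s, where T = UNIV]
      unfolding a_def[symmetric] has_field_derivative_def
      using mult_commute_abs[of "a k"] by metis
    then show "((\<lambda>s. (\<chi> k. \<gamma> s k) \<bullet> e) has_derivative (\<lambda>t. (t *s (\<chi> k. a k)) \<bullet> e)) (at s)"
      unfolding e inner_axis by (simp add: has_derivative_inner_left)
  qed
  moreover have "(\<lambda>t. F (\<chi> k. \<gamma> s k) (t *s (\<chi> k. a k))) = (*) (F (\<chi> k. \<gamma> s k) (\<chi> k. a k))"
    by (rule ext) (simp add: F(2))
  ultimately have "((\<lambda>s. h (\<chi> k. \<gamma> s k)) has_field_derivative F (\<chi> k. \<gamma> s k) (\<chi> k. a k)) (at s)"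
    using has_derivative_compose[OF _ F(1)] unfolding has_field_derivative_def by metis
  then show "(\<lambda>s. h (\<chi> k. \<gamma> s k)) field_differentiable at s within S"
    using field_differentiable_at_within field_differentiable_def by blast
qed

text \<open>
  The integral of \<open>h (z + c w)\<close> over the unit ball is holomorphic in \<open>c\<close>, and rotation
  invariance of Lebesgue measure makes it constant on the unit circle. So it is constant, and its
  values at \<open>c = 1\<close> and \<open>c = 0\<close> are the two sides.
\<close>

lemma entire_ball_mean:
  fixes h :: "complex^'n \<Rightarrow> complex"
  assumes h: "entire h"
  shows "(\<integral>w. indicator (ball 0 1) w *\<^sub>R h (z + w) \<partial>lborel) = measure lborel (ball 0 1 :: (complex^'n) set) *\<^sub>R h z"
proof -
  define B where "B = (ball 0 1 :: (complex^'n) set)"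
  note [measurable] = entire_measurable[OF h]
  have [measurable]: "B \<in> sets borel" by (simp add: B_def)
  have fin: "emeasure lborel B < \<infinity>" unfolding B_def by (rule emeasure_lborel_ball_finite)
  define \<psi> where "\<psi> c = (\<integral>w. indicator B w *\<^sub>R h (z + c *s w) \<partial>lborel)" for c
  obtain K where K: "\<And>y. y \<in> cball z 2 \<Longrightarrow> cmod (h y) \<le> K"
  proof -
    have "compact (h ` cball z 2)"
      by (rule compact_continuous_image) (auto intro: continuous_on_subset[OF entire_continuous[OF h]])
    then have "bounded (h ` cball z 2)" by (rule compact_imp_bounded)
    then show ?thesis using that unfolding bounded_iff by blast
  qed
  have hol: "\<psi> holomorphic_on ball 0 2"
    unfolding \<psi>_def
  proof (rule holomorphic_on_lebesgue_integral[where g = "\<lambda>w. K * indicator B w"])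
    fix c :: complex assume "c \<in> ball 0 2"
    note [measurable] = linear_borel_measurable[OF linear_vector_scalar]
    show "(\<lambda>w. indicator B w *\<^sub>R h (z + c *s w)) \<in> borel_measurable lborel" by measurable
  next
    fix w :: "complex^'n"
    have "(\<lambda>c. h (\<chi> k. z $ k + c * w $ k)) holomorphic_on ball 0 2"
      by (rule entire_holomorphic[OF h]) (auto intro!: holomorphic_intros)
    moreover have "(\<chi> k. z $ k + c * w $ k) = z + c *s w" for c by (simp add: vec_eq_iff)
    ultimately show "(\<lambda>c. indicator B w *\<^sub>R h (z + c *s w)) holomorphic_on ball 0 2"
      by (auto simp: indicator_def)
  next
    fix c w assume c: "c \<in> ball (0::complex) 2"
    show "cmod (indicator B w *\<^sub>R h (z + c *s w)) \<le> K * indicator B w"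
    proof (cases "w \<in> B")
      case True
      then have "cmod c * norm w \<le> 2 * 1" using c by (intro mult_mono) (auto simp: B_def)
      then have "z + c *s w \<in> cball z 2" by (simp add: dist_norm norm_vector_scalar)
      then show ?thesis using K True by simp
    qed simp
  qed (use fin in auto)
  have sph: "\<psi> c = \<psi> 1" if "c \<in> sphere 0 1" for c
  proof -
    have "indicator B w = (indicator B (c *s w) :: real)" for w
      using that by (simp add: B_def indicator_def norm_vector_scalar)
    then have "\<psi> c = (\<integral>w. indicator B (c *s w) *\<^sub>R h (z + c *s w) \<partial>lborel)" by (simp add: \<psi>_def)
    also have "\<dots> = (\<integral>w. indicator B w *\<^sub>R h (z + w) \<partial>lborel)"
      by (rule integral_lborel_isometry[OF linear_vector_scalar])
        (use that in \<open>auto simp: norm_vector_scalar\<close>)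
    finally show ?thesis by (simp add: \<psi>_def)
  qed
  have lp: "(1::complex) islimpt sphere 0 1"
  proof (rule connected_imp_perfect)
    show "connected (sphere (0::complex) 1)" by (rule connected_sphere) simp
    have "(1::complex) \<in> sphere 0 1" "(-1::complex) \<in> sphere 0 1" by auto
    then show "sphere (0::complex) 1 \<noteq> {x}" for x by (metis one_neq_neg_one singletonD)
  qed auto
  have "\<psi> 0 - \<psi> 1 = 0"
  proof (rule analytic_continuation[where f = "\<lambda>c. \<psi> c - \<psi> 1" and S = "ball 0 2", OF _ _ _ _ _ lp])
    show "(\<lambda>c. \<psi> c - \<psi> 1) holomorphic_on ball 0 2" by (intro holomorphic_intros hol)
    show "\<psi> c - \<psi> 1 = 0" if "c \<in> sphere 0 1" for c using sph[OF that] by (rule right_minus_eq[THEN iffD2])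
  qed auto
  then have "\<psi> 1 = \<psi> 0" by simp
  moreover have "\<psi> 0 = measure lborel B *\<^sub>R h z"
    using fin by (simp add: \<psi>_def integral_scaleR_left)
  ultimately show ?thesis by (simp add: \<psi>_def B_def)
qed

section \<open>The Gaussian measure and the Fock space\<close>

lemma sets_gauss [simp, measurable_cong]: "sets gauss_measure = sets borel"
  by (simp add: gauss_measure_def)

lemma space_gauss [simp]: "space gauss_measure = UNIV"
  by (simp add: gauss_measure_def)

lemma integrable_gauss_iff:
  fixes f :: "complex^'n \<Rightarrow> 'b::{banach, second_countable_topology}"
  assumes [measurable]: "f \<in> borel_measurable borel"
  shows "integrable gauss_measure f \<longleftrightarrow> integrable lborel (\<lambda>z. exp (- (norm z)\<^sup>2) *\<^sub>R f z)"
proof -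
  let ?g = "\<lambda>z. exp (- (norm z)\<^sup>2) *\<^sub>R f z"
  have "integrable gauss_measure f \<longleftrightarrow> integrable lborel (\<lambda>z. (exp (- (norm z)\<^sup>2) / pi ^ CARD('n)) *\<^sub>R f z)"
    unfolding gauss_measure_def by (rule integrable_density) auto
  also have "(\<lambda>z. (exp (- (norm z)\<^sup>2) / pi ^ CARD('n)) *\<^sub>R f z) = (\<lambda>z. (1 / pi ^ CARD('n)) *\<^sub>R ?g z)"
    by (simp add: divide_inverse mult.commute)
  also have "integrable lborel \<dots> \<longleftrightarrow> integrable lborel ?g"
    using integrable_scaleR_right[of "pi ^ CARD('n)" lborel "\<lambda>z. (1 / pi ^ CARD('n)) *\<^sub>R ?g z"]
      integrable_scaleR_right[of "1 / pi ^ CARD('n)" lborel ?g]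
    by (auto simp del: integrable_scaleR_right)
  finally show ?thesis .
qed

lemma integral_gauss:
  fixes f :: "complex^'n \<Rightarrow> 'b::{banach, second_countable_topology}"
  assumes [measurable]: "f \<in> borel_measurable borel"
  shows "integral\<^sup>L gauss_measure f = (1 / pi ^ CARD('n)) *\<^sub>R (\<integral>z. exp (- (norm z)\<^sup>2) *\<^sub>R f z \<partial>lborel)"
proof -
  have "integral\<^sup>L gauss_measure f = (\<integral>z. (exp (- (norm z)\<^sup>2) / pi ^ CARD('n)) *\<^sub>R f z \<partial>lborel)"
    unfolding gauss_measure_def by (rule integral_density) auto
  also have "(\<lambda>z. (exp (- (norm z)\<^sup>2) / pi ^ CARD('n)) *\<^sub>R f z)
      = (\<lambda>z. (1 / pi ^ CARD('n)) *\<^sub>R (exp (- (norm z)\<^sup>2) *\<^sub>R f z))"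
    by (simp add: divide_inverse mult.commute)
  finally show ?thesis by (simp only: integral_scaleR_right)
qed

lemma gauss_L2_iff:
  assumes "u \<in> borel_measurable borel"
  shows "u \<in> gauss_L2 \<longleftrightarrow> integrable lborel (\<lambda>z. exp (- (norm z)\<^sup>2) * (cmod (u z))\<^sup>2)"
  using assms by (simp add: gauss_L2_def integrable_gauss_iff cong: measurable_cong_sets)

lemma gauss_L2_mult_cnj:
  assumes u: "u \<in> gauss_L2" and v: "v \<in> gauss_L2"
  shows "integrable gauss_measure (\<lambda>z. u z * cnj (v z))"
proof (rule Bochner_Integration.integrable_bound)
  show "integrable gauss_measure (\<lambda>z. (cmod (u z))\<^sup>2 + (cmod (v z))\<^sup>2)"
    using u v by (auto simp: gauss_L2_def)
  have "cnj \<in> borel_measurable borel" by (intro borel_measurable_continuous_onI continuous_intros)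
  then have "(\<lambda>z. cnj (v z)) \<in> borel_measurable gauss_measure"
    using v by (auto simp: gauss_L2_def)
  then show "(\<lambda>z. u z * cnj (v z)) \<in> borel_measurable gauss_measure"
    using u by (auto simp: gauss_L2_def)
  have "a * b \<le> a\<^sup>2 + b\<^sup>2" for a b :: real
  proof -
    have "2 * (a * b) \<le> a\<^sup>2 + b\<^sup>2" using sum_squares_bound[of a b] by (simp add: mult.assoc)
    then show ?thesis using zero_le_power2[of a] zero_le_power2[of b] by linarith
  qed
  then show "AE z in gauss_measure. norm (u z * cnj (v z)) \<le> norm ((cmod (u z))\<^sup>2 + (cmod (v z))\<^sup>2)"
    by (auto simp: norm_mult)
qed

lemma gauss_L2_add:
  assumes "u \<in> gauss_L2" "v \<in> gauss_L2"
  shows "(\<lambda>z. u z + v z) \<in> gauss_L2"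
proof -
  have "integrable gauss_measure (\<lambda>z. (cmod (u z + v z))\<^sup>2)"
  proof (rule Bochner_Integration.integrable_bound)
    show "integrable gauss_measure (\<lambda>z. 2 * (cmod (u z))\<^sup>2 + 2 * (cmod (v z))\<^sup>2)"
      using assms by (auto simp: gauss_L2_def)
    show "(\<lambda>z. (cmod (u z + v z))\<^sup>2) \<in> borel_measurable gauss_measure"
      using assms by (auto simp: gauss_L2_def)
    have "(cmod (a + b))\<^sup>2 \<le> 2 * (cmod a)\<^sup>2 + 2 * (cmod b)\<^sup>2" for a b
    proof -
      have "(cmod (a + b))\<^sup>2 \<le> (cmod a + cmod b)\<^sup>2"
        by (simp add: norm_triangle_ineq power_mono)
      also have "\<dots> \<le> 2 * (cmod a)\<^sup>2 + 2 * (cmod b)\<^sup>2"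
        using sum_squares_bound[of "cmod a" "cmod b"] by (simp add: power2_sum)
      finally show ?thesis .
    qed
    then show "AE z in gauss_measure. norm ((cmod (u z + v z))\<^sup>2) \<le> norm (2 * (cmod (u z))\<^sup>2 + 2 * (cmod (v z))\<^sup>2)"
      by auto
  qed
  then show ?thesis using assms by (auto simp: gauss_L2_def)
qed

lemma gauss_L2_cmult: "u \<in> gauss_L2 \<Longrightarrow> (\<lambda>z. a * u z) \<in> gauss_L2"
  by (auto simp: gauss_L2_def norm_mult power_mult_distrib)

lemma gauss_inner_add:
  assumes "u \<in> gauss_L2" "v \<in> gauss_L2" "q \<in> gauss_L2"
  shows "gauss_inner (\<lambda>z. u z + v z) q = gauss_inner u q + gauss_inner v q"
  unfolding gauss_inner_def distrib_right
  by (intro Bochner_Integration.integral_add gauss_L2_mult_cnj assms)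

lemma gauss_inner_cmult: "gauss_inner (\<lambda>z. a * u z) q = a * gauss_inner u q"
  by (simp add: gauss_inner_def mult.assoc)

lemma fock_space_iff: "h \<in> fock_space \<longleftrightarrow> h \<in> gauss_L2 \<and> entire h"
  by (auto simp: fock_space_def)

lemma fock_space_diff:
  assumes "f \<in> fock_space" "g \<in> fock_space"
  shows "(\<lambda>z. f z - g z) \<in> fock_space"
proof -
  have "(\<lambda>z. f z + - 1 * g z) \<in> fock_space"
    using assms by (simp only: fock_space_iff gauss_L2_add gauss_L2_cmult entire_add entire_cmult)
  then show ?thesis by simp
qed

text \<open>
  The mean value over the unit ball around \<open>z\<close> bounds \<open>\<bar>h z\<bar>\<close> by the norm of \<open>h\<close>,
  at the price of \<open>exp ((\<bar>z\<bar> + 1)\<^sup>2 / 2)\<close>, the square root of the largest inverse Gaussian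
  weight on that ball.
\<close>

lemma fock_growth:
  fixes h :: "complex^'n \<Rightarrow> complex"
  assumes "h \<in> fock_space"
  obtains C where "C \<ge> 0" "\<And>z. cmod (h z) \<le> C * exp ((norm z)\<^sup>2 / 2 + norm z)"
proof -
  have h: "entire h" "h \<in> gauss_L2" using assms by (auto simp: fock_space_iff)
  note hm[measurable] = entire_measurable[OF h(1)]
  define B where "B = (ball 0 1 :: (complex^'n) set)"
  have [measurable]: "B \<in> sets borel" by (simp add: B_def)
  have fin: "emeasure lborel B < \<infinity>" unfolding B_def by (rule emeasure_lborel_ball_finite)
  define V where "V = measure lborel B"
  have V: "V > 0" unfolding V_def B_def using content_ball_pos[of 1 0] by simp
  let ?p = "\<lambda>u. exp (- (norm u)\<^sup>2) * (cmod (h u))\<^sup>2"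
  define I where "I = (\<integral>u. ?p u \<partial>lborel)"
  have p: "integrable lborel ?p" using h(2) gauss_L2_iff[OF hm] by simp
  have I: "I \<ge> 0" unfolding I_def by (rule integral_nonneg_AE) simp
  have main: "cmod (h z) \<le> (V + I) / (2 * V) * exp (1 / 2) * exp ((norm z)\<^sup>2 / 2 + norm z)" for z
  proof -
    define lm where "lm = exp ((norm z + 1)\<^sup>2 / 2)"
    have lm: "lm > 0" "lm\<^sup>2 = exp ((norm z + 1)\<^sup>2)"
      by (simp_all add: lm_def flip: exp_double)
    have pz: "integrable lborel (\<lambda>w. ?p (z + w))" "(\<integral>w. ?p (z + w) \<partial>lborel) = I"
    proof -
      have "integrable (distr lborel borel ((+) z)) ?p" using p by (simp add: lborel_distr_plus)
      then show "integrable lborel (\<lambda>w. ?p (z + w))" by (subst (asm) integrable_distr_eq) auto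
      have "I = (\<integral>u. ?p u \<partial>distr lborel borel ((+) z))" by (simp add: I_def lborel_distr_plus)
      then show "(\<integral>w. ?p (z + w) \<partial>lborel) = I" by (subst (asm) integral_distr) auto
    qed
    \<comment> \<open>The weight \<open>lm\<close> balances the two terms of \<open>2 a \<le> lm + a\<^sup>2 / lm\<close>, so that both grow like \<open>lm\<close>.\<close>
    have bd: "cmod (indicator B w *\<^sub>R h (z + w)) \<le> lm / 2 * indicator B w + lm / 2 * ?p (z + w)" for w
    proof (cases "w \<in> B")
      case True
      then have "norm (z + w) \<le> norm z + 1" using norm_triangle_ineq[of z w] by (simp add: B_def)
      then have "(norm (z + w))\<^sup>2 \<le> (norm z + 1)\<^sup>2" by (simp add: power_mono)
      then have "1 \<le> lm\<^sup>2 * exp (- (norm (z + w))\<^sup>2)" by (simp add: lm flip: exp_add)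
      then have "(cmod (h (z + w)))\<^sup>2 \<le> lm\<^sup>2 * ?p (z + w)"
        using mult_right_mono[of 1 "lm\<^sup>2 * exp (- (norm (z + w))\<^sup>2)" "(cmod (h (z + w)))\<^sup>2"]
        by (simp add: mult.assoc)
      moreover have "2 * cmod (h (z + w)) * lm \<le> lm\<^sup>2 + (cmod (h (z + w)))\<^sup>2"
        using sum_squares_bound[of lm "cmod (h (z + w))"] by (simp add: mult_ac)
      ultimately have "cmod (h (z + w)) * lm \<le> (lm / 2 + lm / 2 * ?p (z + w)) * lm"
        by (simp add: power2_eq_square algebra_simps)
      then have "cmod (h (z + w)) \<le> lm / 2 + lm / 2 * ?p (z + w)"
        using lm(1) by (rule mult_right_le_imp_le)
      then show ?thesis using True by simp
    qed (use lm in simp)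
    have "V * cmod (h z) = cmod (\<integral>w. indicator B w *\<^sub>R h (z + w) \<partial>lborel)"
      unfolding V_def B_def entire_ball_mean[OF h(1)] by simp
    also have "\<dots> \<le> (\<integral>w. cmod (indicator B w *\<^sub>R h (z + w)) \<partial>lborel)"
      by (rule integral_norm_bound)
    also have "\<dots> \<le> (\<integral>w. lm / 2 * indicator B w + lm / 2 * ?p (z + w) \<partial>lborel)"
      by (rule Bochner_Integration.integral_mono_AE') (use fin pz lm bd in \<open>auto intro!: AE_I2\<close>)
    also have "\<dots> = lm / 2 * (V + I)"
      using fin pz by (subst Bochner_Integration.integral_add) (auto simp: V_def algebra_simps)
    finally have "cmod (h z) \<le> (V + I) / (2 * V) * lm" using V by (simp add: field_simps)
    also have "lm = exp (1 / 2) * exp ((norm z)\<^sup>2 / 2 + norm z)"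
      by (simp add: lm_def power2_eq_square field_simps flip: exp_add)
    finally show ?thesis by (simp add: mult.assoc)
  qed
  show ?thesis by (rule that[OF _ main]) (use V I in auto)
qed

lemma fock_spaceI_growth:
  fixes h :: "complex^'n \<Rightarrow> complex"
  assumes h: "entire h" and b: "\<And>z. cmod (h z) \<le> C * exp (a * (norm z)\<^sup>2 + m * norm z)" and a: "a < 1 / 2"
  shows "h \<in> fock_space"
proof -
  have "integrable lborel (\<lambda>z. exp (- (norm z)\<^sup>2) * (cmod (h z))\<^sup>2)"
  proof (rule Bochner_Integration.integrable_bound)
    show "integrable lborel (\<lambda>z::complex^'n. C\<^sup>2 * exp (2 * m * norm z - (1 - 2 * a) * (norm z)\<^sup>2))"
      using a by (intro integrable_mult_right integrable_gaussian_linear) simp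
    show "(\<lambda>z. exp (- (norm z)\<^sup>2) * (cmod (h z))\<^sup>2) \<in> borel_measurable lborel"
      using entire_measurable[OF h] by measurable
    have "exp (- (norm z)\<^sup>2) * (cmod (h z))\<^sup>2 \<le> C\<^sup>2 * exp (2 * m * norm z - (1 - 2 * a) * (norm z)\<^sup>2)" for z
    proof -
      have "(cmod (h z))\<^sup>2 \<le> (C * exp (a * (norm z)\<^sup>2 + m * norm z))\<^sup>2"
        using b[of z] by (simp add: power_mono)
      then have "exp (- (norm z)\<^sup>2) * (cmod (h z))\<^sup>2 \<le> exp (- (norm z)\<^sup>2) * (C * exp (a * (norm z)\<^sup>2 + m * norm z))\<^sup>2"
        by simp
      also have "\<dots> = C\<^sup>2 * exp (2 * m * norm z - (1 - 2 * a) * (norm z)\<^sup>2)"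
        by (simp add: power_mult_distrib algebra_simps flip: exp_add exp_double)
      finally show ?thesis .
    qed
    then show "AE z in lborel. norm (exp (- (norm z)\<^sup>2) * (cmod (h z))\<^sup>2)
        \<le> norm (C\<^sup>2 * exp (2 * m * norm z - (1 - 2 * a) * (norm z)\<^sup>2))"
      by auto
  qed
  then show ?thesis using h entire_measurable[OF h] by (simp add: fock_space_iff gauss_L2_iff)
qed

lemma fock_space_isometry:
  fixes U :: "complex^'n \<Rightarrow> complex^'n"
  assumes h: "h \<in> fock_space" and U: "linear U" "\<And>x. norm (U x) = norm x" "\<And>c v. U (c *s v) = c *s U v"
  shows "(\<lambda>z. h (U z)) \<in> fock_space"
proof -
  have e: "entire h" "entire (\<lambda>z. h (U z))"
    using h entire_compose_linear[of h U] U by (auto simp: fock_space_iff)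
  note [measurable] = entire_measurable[OF e(1)] linear_borel_measurable[OF U(1)]
  have "integrable (distr lborel borel U) (\<lambda>z. exp (- (norm z)\<^sup>2) * (cmod (h z))\<^sup>2)"
    unfolding distr_lborel_isometry[OF U(1,2)]
    using h gauss_L2_iff[OF entire_measurable[OF e(1)]] by (simp add: fock_space_iff)
  then have "integrable lborel (\<lambda>z. exp (- (norm z)\<^sup>2) * (cmod (h (U z)))\<^sup>2)"
    by (subst (asm) integrable_distr_eq) (auto simp: U(2))
  then show ?thesis using e entire_measurable[OF e(2)] by (simp add: fock_space_iff gauss_L2_iff)
qed

lemma fock_space_contraction:
  fixes A :: "complex^'n \<Rightarrow> complex^'n"
  assumes h: "h \<in> fock_space" and A: "linear A" "\<And>c v. A (c *s v) = c *s A v" and n: "\<And>z. norm (A z) \<le> norm z / 2"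
  shows "(\<lambda>z. h (A z)) \<in> fock_space"
proof -
  have e: "entire h" using h by (simp add: fock_space_iff)
  obtain C where C: "C \<ge> 0" "\<And>z. cmod (h z) \<le> C * exp ((norm z)\<^sup>2 / 2 + norm z)"
    using fock_growth[OF h] by blast
  show ?thesis
  proof (rule fock_spaceI_growth[where C = C and a = "1 / 4" and m = 1, OF entire_compose_linear[OF e A]])
    fix z
    have "(norm (A z))\<^sup>2 \<le> (norm z / 2)\<^sup>2" using n by (intro power_mono) auto
    then have "(norm (A z))\<^sup>2 \<le> (norm z)\<^sup>2 / 4" by (simp add: power_divide)
    then have "(norm (A z))\<^sup>2 / 2 + norm (A z) \<le> 1 / 4 * (norm z)\<^sup>2 + 1 * norm z"
      using n[of z] zero_le_power2[of "norm z"] norm_ge_zero[of z] by linarith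
    then have "C * exp ((norm (A z))\<^sup>2 / 2 + norm (A z)) \<le> C * exp (1 / 4 * (norm z)\<^sup>2 + 1 * norm z)"
      using C(1) by (intro mult_left_mono) auto
    with C(2)[of "A z"] show "cmod (h (A z)) \<le> C * exp (1 / 4 * (norm z)\<^sup>2 + 1 * norm z)"
      by (rule order_trans)
  qed simp
qed

lemma gauss_inner_self_zero:
  assumes d: "d \<in> fock_space" and z: "gauss_inner d d = 0"
  shows "d = (\<lambda>_. 0)"
proof -
  have int: "integrable gauss_measure (\<lambda>z. (cmod (d z))\<^sup>2)"
    using d by (auto simp: fock_space_iff gauss_L2_def)
  have "complex_of_real (\<integral>z. (cmod (d z))\<^sup>2 \<partial>gauss_measure) = 0"
    using z by (simp add: gauss_inner_def complex_norm_square[symmetric] flip: integral_complex_of_real of_real_power)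
  then have "(\<integral>z. (cmod (d z))\<^sup>2 \<partial>gauss_measure) = 0" by (simp only: of_real_eq_0_iff)
  then have "AE z in gauss_measure. (cmod (d z))\<^sup>2 = 0"
    using integral_nonneg_eq_0_iff_AE[OF int] by simp
  then have "AE z in lborel. d z = 0"
    unfolding gauss_measure_def by (subst (asm) AE_density) auto
  then show ?thesis using continuous_AE_zero[OF entire_continuous] d by (auto simp: fock_space_iff)
qed

text \<open>
  Two candidates for the projection differ by an element of the Fock space that is orthogonal to
  itself, hence zero almost everywhere, hence zero by continuity.
\<close>

lemma fock_proj_eqI:
  assumes u: "u \<in> gauss_L2" and k: "k \<in> fock_space"
    and eq: "\<And>q. q \<in> fock_space \<Longrightarrow> gauss_inner u q = gauss_inner k q"
  shows "fock_proj u = k"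
proof -
  have diff: "gauss_inner (\<lambda>z. a z - b z) q = gauss_inner a q - gauss_inner b q"
    if "a \<in> gauss_L2" "b \<in> gauss_L2" "q \<in> gauss_L2" for a b q :: "complex^'a \<Rightarrow> complex"
    unfolding gauss_inner_def left_diff_distrib
    by (intro Bochner_Integration.integral_diff gauss_L2_mult_cnj that)
  have L2: "f \<in> gauss_L2" if "f \<in> fock_space" for f :: "complex^'a \<Rightarrow> complex"
    using that by (simp add: fock_space_iff)
  show ?thesis
    unfolding fock_proj_def
  proof (rule the_equality)
    show "k \<in> fock_space \<and> (\<forall>q\<in>fock_space. gauss_inner (\<lambda>z. u z - k z) q = 0)"
      using k eq diff[OF u L2[OF k] L2] by simp
  next
    fix h assume h: "h \<in> fock_space \<and> (\<forall>q\<in>fock_space. gauss_inner (\<lambda>z. u z - h z) q = 0)"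
    let ?d = "\<lambda>z. h z - k z"
    have d: "?d \<in> fock_space" using h k by (simp add: fock_space_diff)
    have "gauss_inner u ?d = gauss_inner h ?d"
      using h d diff[OF u L2 L2[OF d], of h] by simp
    then have "gauss_inner ?d ?d = 0"
      using eq[OF d] diff[OF L2 L2[OF k] L2[OF d], of h] h by simp
    from gauss_inner_self_zero[OF d this] show "h = k" by (simp add: fun_eq_iff)
  qed
qed

section \<open>Diagonal complex Gaussians\<close>

text \<open>
  For \<open>ln b = la + \<i> \<kappa>\<close>, the right-hand side is the decay rate of the Gaussian in the proof
  of the next lemma at the parameter \<open>\<i> y\<close>, and the first summand on the left is the growth
  rate of the product of the two Fock space functions. The second summand is a lower bound for the
  margin between them: it interpolates linearly between the values of the margin at the end points,
  because the cosine is concave on the relevant interval and the exponential function is convex.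
\<close>

lemma cos_exp_path_inequality:
  fixes \<kappa> la y :: real
  assumes ka: "\<bar>\<kappa>\<bar> \<le> pi / 2" and y: "0 \<le> y" "y \<le> 1"
  shows "(exp (- la * (1 + y)) + exp (- la * (1 - y))) / 2
      + (y * ((1 - exp (- 2 * la)) / 2) + (1 - y) * (cos \<kappa> - exp (- la))) \<le> cos (\<kappa> * (1 - y))"
proof -
  have "convex_on {- (pi / 2)..pi / 2} (\<lambda>x. - cos x)"
  proof (rule f''_ge0_imp_convex[where f' = sin and f'' = cos])
    show "((\<lambda>x. - cos x) has_real_derivative sin x) (at x)" for x
      by (auto intro!: derivative_eq_intros)
    show "(sin has_real_derivative cos x) (at x)" for x by (rule DERIV_sin)
    show "0 \<le> cos x" if "x \<in> {- (pi / 2)..pi / 2}" for x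
      using that by (intro cos_ge_zero) auto
  qed simp
  moreover have "- (pi / 2) \<le> \<kappa>" "\<kappa> \<le> pi / 2" using ka by linarith+
  ultimately have 1: "(1 - y) * cos \<kappa> + y \<le> cos (\<kappa> * (1 - y))"
    using convex_onD[of "{- (pi / 2)..pi / 2}" "\<lambda>x. - cos x" y \<kappa> 0] y
    by (simp add: mult.commute)
  have 2: "exp (- la * (1 + y)) \<le> (1 - y) * exp (- la) + y * exp (- 2 * la)"
    using convex_onD[OF exp_convex, of y "- la" "- 2 * la"] y by (simp add: algebra_simps)
  have 3: "exp (- la * (1 - y)) \<le> (1 - y) * exp (- la) + y"
    using convex_onD[OF exp_convex, of y "- la" 0] y by (simp add: algebra_simps)
  have 4: "y * ((1 - exp (- 2 * la)) / 2) = y / 2 - y * exp (- 2 * la) / 2"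
    by (simp add: field_simps)
  have 5: "(1 - y) * (cos \<kappa> - exp (- la)) = (1 - y) * cos \<kappa> - (1 - y) * exp (- la)"
    by (simp add: algebra_simps)
  show ?thesis unfolding 4 5 using 1 2 3 by argo
qed

text \<open>
  Consider \<open>Q = \<Prod> c\<^sub>k d\<^sub>k \<integral> exp (- \<Sum> b\<^sub>k c\<^sub>k d\<^sub>k \<bar>z\<^sub>k\<bar>\<^sup>2) h (c z) cnj (q (cnj d z))\<close>, which is
  holomorphic in the parameters \<open>c, d\<close>. If \<open>d\<^sub>k\<close> is the conjugate of \<open>c\<^sub>k\<close> then
  substituting \<open>c\<^sub>k z\<^sub>k\<close> for \<open>z\<^sub>k\<close> shows that \<open>Q\<close> is the left-hand side, and for
  \<open>c\<^sub>k = 1 / b\<^sub>k\<close>, \<open>d\<^sub>k = 1\<close> it is the right-hand side. The proof moves the parameters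
  along a complex curve \<open>s \<mapsto> (c, d)\<close> that consists of conjugate pairs for real \<open>s\<close> and
  reaches the second configuration at \<open>s = \<i>\<close>; the identity theorem then gives
  \<open>Q 0 = Q \<i>\<close>. The curve is chosen so that \<open>\<bar>b\<^sub>k c\<^sub>k d\<^sub>k\<bar> = 1\<close> on the segment from
  \<open>0\<close> to \<open>\<i>\<close>, where the integrals must converge.
\<close>

lemma gaussian_diag_identity:
  fixes h q :: "complex^'n \<Rightarrow> complex" and b :: "'n \<Rightarrow> complex"
  assumes h: "h \<in> fock_space" and q: "q \<in> fock_space" and b: "\<And>k. Re (b k) > 1"
  shows "(\<integral>z. exp (- (\<Sum>k\<in>UNIV. b k * of_real ((cmod (z $ k))\<^sup>2))) * (h z * cnj (q z)) \<partial>lborel)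
    = (\<Prod>k\<in>UNIV. 1 / b k) *
      (\<integral>z. of_real (exp (- (norm z)\<^sup>2)) * (h (cdiag (\<lambda>k. 1 / b k) z) * cnj (q z)) \<partial>lborel)"
proof -
  have eh: "entire h" and eq: "entire q" using h q by (auto simp: fock_space_iff)
  note [measurable] = entire_measurable[OF eh] entire_measurable[OF eq]
  obtain C1 where C1: "C1 \<ge> 0" "\<And>z. cmod (h z) \<le> C1 * exp ((norm z)\<^sup>2 / 2 + norm z)"
    using fock_growth[OF h] by blast
  obtain C2 where C2: "C2 \<ge> 0" "\<And>z. cmod (q z) \<le> C2 * exp ((norm z)\<^sup>2 / 2 + norm z)"
    using fock_growth[OF q] by blast
  define la ka where "la k = ln (cmod (b k))" and "ka k = Im (Ln (b k))" for k
  have b0: "b k \<noteq> 0" for k using b[of k] by auto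
  have b1: "cmod (b k) > 1" for k using b[of k] complex_Re_le_cmod[of "b k"] by linarith
  have la: "la k > 0" for k using ln_gt_zero[OF b1[of k]] by (simp add: la_def)
  have bexp: "b k = exp (of_real (la k) + \<i> * of_real (ka k))" for k
  proof -
    have "Ln (b k) = of_real (la k) + \<i> * of_real (ka k)"
      using b0[of k] by (simp add: complex_eq_iff la_def ka_def)
    then show ?thesis using exp_Ln[OF b0[of k]] by simp
  qed
  have ka: "\<bar>ka k\<bar> \<le> pi / 2" for k
    using Re_Ln_pos_lt_imp[of "b k"] b[of k] by (simp add: ka_def)
  have Reb: "Re (b k) = exp (la k) * cos (ka k)" for k
    by (subst bexp) (simp add: Re_exp)
  \<comment> \<open>With \<open>l = ln b\<close>, the curve is \<open>c = exp (u + \<i> v)\<close>, \<open>d = exp (u - \<i> v)\<close> for the affine functions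
    \<open>u = - (la + ka s) / 2\<close> and \<open>v = (la s - ka) / 2\<close>. They are real for real \<open>s\<close>, which makes
    \<open>c\<close> and \<open>d\<close> conjugate, and \<open>s = \<i>\<close> gives \<open>u = - l / 2\<close>, \<open>v = \<i> l / 2\<close>.\<close>
  define c d where "c s k = exp (- (of_real (la k) + of_real (ka k) * s) / 2 + \<i> * (of_real (la k) * s - of_real (ka k)) / 2)"
    and "d s k = exp (- (of_real (la k) + of_real (ka k) * s) / 2 - \<i> * (of_real (la k) * s - of_real (ka k)) / 2)"
    for s k
  define bcd where "bcd s k = b k * c s k * d s k" for s k
  have c_hol: "(\<lambda>s. c s k) holomorphic_on A" for k A
    unfolding c_def by (intro holomorphic_intros) simp_all
  have d_hol: "(\<lambda>s. d s k) holomorphic_on A" for k A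
    unfolding d_def by (intro holomorphic_intros) simp_all
  have bcd_hol: "(\<lambda>s. bcd s k) holomorphic_on A" for k A
    unfolding bcd_def by (intro holomorphic_intros c_hol d_hol)
  have expo: "(A + \<i> * B) + (- (A + B * s) / 2 + \<i> * (A * s - B) / 2) + (- (A + B * s) / 2 - \<i> * (A * s - B) / 2)
      = \<i> * B * (1 + \<i> * s)" for A B s :: complex
  proof -
    have "\<i> * B * (1 + \<i> * s) = \<i> * B + (\<i> * \<i>) * (B * s)" by (simp only: distrib_left mult_1_right mult_ac)
    then show ?thesis by (simp add: add_divide_distrib diff_divide_distrib)
  qed
  have bcd: "bcd s k = exp (\<i> * of_real (ka k) * (1 + \<i> * s))" for s k
    unfolding bcd_def c_def d_def by (subst bexp) (simp only: exp_add[symmetric] expo)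
  have c_i: "c \<i> k = 1 / b k" and d_i: "d \<i> k = 1" for k
  proof -
    have "- (A + B * \<i>) / 2 + \<i> * (A * \<i> - B) / 2 = - (A + \<i> * B)"
      and "- (A + B * \<i>) / 2 - \<i> * (A * \<i> - B) / 2 = 0" for A B :: complex
      by (simp_all add: complex_eq_iff)
    then show "c \<i> k = 1 / b k" "d \<i> k = 1"
      unfolding c_def d_def by (simp_all only: bexp[of k] exp_minus divide_inverse mult_1_left exp_zero)
  qed
  define F where "F s z = (\<Prod>k\<in>UNIV. c s k * d s k)
      * exp (- (\<Sum>k\<in>UNIV. bcd s k * of_real ((cmod (z $ k))\<^sup>2)))
      * (h (\<chi> k. c s k * z $ k) * cnj (q (vcnj (\<chi> k. d s k * cnj (z $ k)))))" for s and z :: "complex^'n"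
  define Q where "Q s = (\<integral>z. F s z \<partial>lborel)" for s
  define m where "m k = min ((1 - exp (- 2 * la k)) / 2) (cos (ka k) - exp (- la k))" for k
  define \<delta> where "\<delta> = Min (range m) / 2"
  have m: "m k > 0" for k
  proof -
    have "exp (- la k) * 1 < exp (- la k) * (exp (la k) * cos (ka k))"
      using b[of k] unfolding Reb by (intro mult_strict_left_mono) auto
    also have "\<dots> = cos (ka k)" by (simp add: mult.assoc[symmetric] flip: exp_add)
    finally have "exp (- la k) < cos (ka k)" by simp
    moreover have "exp (- 2 * la k) < 1" using la[of k] by simp
    ultimately show ?thesis by (simp add: m_def)
  qed
  then have \<delta>: "\<delta> > 0" by (simp add: \<delta>_def)
  have \<delta>m: "\<delta> < m k" for k
  proof -
    have "2 * \<delta> \<le> m k" by (simp add: \<delta>_def)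
    then show ?thesis using \<delta> by linarith
  qed
  \<comment> \<open>On this open set the Gaussian dominates the product of the growth bounds of \<open>h\<close> and \<open>q\<close>
    with a margin \<open>\<delta>\<close>, uniformly in \<open>s\<close>.\<close>
  define S0 where "S0 = {s. \<forall>k. (((cmod (c s k))\<^sup>2 + (cmod (d s k))\<^sup>2) / 2 + \<delta> < Re (bcd s k)
      \<and> cmod (c s k) < 2) \<and> cmod (d s k) < 2}"
  have "open S0"
  proof -
    have cc: "continuous_on UNIV (\<lambda>s. c s k)" "continuous_on UNIV (\<lambda>s. d s k)" "continuous_on UNIV (\<lambda>s. bcd s k)" for k
      using c_hol d_hol bcd_hol by (auto intro: holomorphic_on_imp_continuous_on)
    have "S0 = (\<Inter>k. ({s. ((cmod (c s k))\<^sup>2 + (cmod (d s k))\<^sup>2) / 2 + \<delta> < Re (bcd s k)}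
        \<inter> {s. cmod (c s k) < 2}) \<inter> {s. cmod (d s k) < 2})"
      by (auto simp: S0_def)
    also have "open \<dots>"
      by (intro open_INT open_Int open_Collect_less continuous_intros cc ballI) auto
    finally show ?thesis .
  qed
  have seg: "\<i> * of_real y \<in> S0" if y: "0 \<le> y" "y \<le> 1" for y
  proof -
    have nc: "cmod (c (\<i> * of_real y) k) = exp (- la k * (1 + y) / 2)" for k
      by (simp add: c_def norm_exp_eq_Re algebra_simps add_divide_distrib)
    have nd: "cmod (d (\<i> * of_real y) k) = exp (- la k * (1 - y) / 2)" for k
      by (simp add: d_def norm_exp_eq_Re algebra_simps add_divide_distrib diff_divide_distrib)
    have "Re (bcd (\<i> * of_real y) k) = cos (ka k * (1 - y))" for k
      by (simp add: bcd Re_exp algebra_simps)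
    moreover have "(cmod (c (\<i> * of_real y) k))\<^sup>2 = exp (- la k * (1 + y))"
      "(cmod (d (\<i> * of_real y) k))\<^sup>2 = exp (- la k * (1 - y))" for k
      unfolding nc nd by (simp_all flip: exp_double)
    moreover have "\<delta> < y * ((1 - exp (- 2 * la k)) / 2) + (1 - y) * (cos (ka k) - exp (- la k))" for k
    proof -
      have "m k = y * m k + (1 - y) * m k" by (simp add: algebra_simps)
      also have "\<dots> \<le> y * ((1 - exp (- 2 * la k)) / 2) + (1 - y) * (cos (ka k) - exp (- la k))"
        unfolding m_def using y by (intro add_mono mult_left_mono min.cobounded1 min.cobounded2) auto
      finally show ?thesis using \<delta>m[of k] by linarith
    qed
    ultimately have "((cmod (c (\<i> * of_real y) k))\<^sup>2 + (cmod (d (\<i> * of_real y) k))\<^sup>2) / 2 + \<delta> < Re (bcd (\<i> * of_real y) k)" for k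
      using cos_exp_path_inequality[OF ka[of k] y, of "la k"] by (smt (verit))
    moreover have "exp (- la k * (1 + y) / 2) < 2" "exp (- la k * (1 - y) / 2) < 2" for k
    proof -
      have "exp (- la k * (1 + y) / 2) \<le> exp 0" "exp (- la k * (1 - y) / 2) \<le> exp 0"
        using la[of k] y unfolding exp_le_cancel_iff by (simp_all add: mult_nonneg_nonneg)
      then show "exp (- la k * (1 + y) / 2) < 2" "exp (- la k * (1 - y) / 2) < 2"
        unfolding exp_zero by linarith+
    qed
    ultimately show ?thesis unfolding S0_def mem_Collect_eq nc nd by blast
  qed
  \<comment> \<open>The identity theorem needs a connected domain; the segment from \<open>0\<close> to \<open>\<i>\<close> lies in one component.\<close>
  define S where "S = connected_component_set S0 0"
  have S: "open S" "connected S" "S \<subseteq> S0"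
    using open_connected_component[OF \<open>open S0\<close>] connected_component_subset
    by (auto simp: S_def)
  have "closed_segment 0 \<i> \<subseteq> S"
    unfolding S_def
  proof (rule connected_component_maximal)
    show "closed_segment 0 \<i> \<subseteq> S0"
      using seg by (auto simp: closed_segment_def scaleR_conv_of_real mult.commute)
  qed auto
  then have S01: "0 \<in> S" "\<i> \<in> S" by auto
  have meas: "F s \<in> borel_measurable borel" for s
  proof -
    have 1: "(\<lambda>z. h (\<chi> k. c s k * z $ k)) \<in> borel_measurable borel"
      using linear_borel_measurable[OF linear_cdiag[of "c s"]] unfolding cdiag_def[abs_def] by measurable
    have v: "vcnj (\<chi> k. d s k * cnj (z $ k)) = cdiag (\<lambda>k. cnj (d s k)) z" for z :: "complex^'n"
      by (simp add: vec_eq_iff vcnj_def)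
    have "cnj \<in> borel_measurable borel" by (intro borel_measurable_continuous_onI continuous_intros)
    then have 2: "(\<lambda>z. cnj (q (vcnj (\<chi> k. d s k * cnj (z $ k))))) \<in> borel_measurable borel"
      using linear_borel_measurable[OF linear_cdiag[of "\<lambda>k. cnj (d s k)"]] unfolding v by measurable
    have 3: "(\<lambda>z. exp (- (\<Sum>k\<in>UNIV. bcd s k * of_real ((cmod (z $ k))\<^sup>2)))) \<in> borel_measurable borel"
      by (intro borel_measurable_continuous_onI continuous_intros)
    show ?thesis unfolding F_def using 1 2 3 by (intro borel_measurable_times borel_measurable_const)
  qed
  have "Q holomorphic_on S"
    unfolding Q_def
  proof (rule holomorphic_on_lebesgue_integral[OF S(1), where
        g = "\<lambda>z. 4 ^ CARD('n) * (C1 * C2) * exp (4 * norm z - \<delta> * (norm z)\<^sup>2)"])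
    show "F s \<in> borel_measurable lborel" for s using meas[of s] by simp
    show "integrable lborel (\<lambda>z::complex^'n. 4 ^ CARD('n) * (C1 * C2) * exp (4 * norm z - \<delta> * (norm z)\<^sup>2))"
      by (intro integrable_mult_right integrable_gaussian_linear \<delta>)
  next
    fix z :: "complex^'n"
    have "(\<lambda>s. h (\<chi> k. c s k * z $ k)) holomorphic_on S"
      by (rule entire_holomorphic[OF eh S(1)]) (intro holomorphic_intros c_hol)
    moreover have "(\<lambda>s. cnj (q (vcnj (\<chi> k. d s k * cnj (z $ k))))) holomorphic_on S"
      by (rule entire_holomorphic[OF entire_cnj[OF eq] S(1)]) (intro holomorphic_intros d_hol)
    ultimately show "(\<lambda>s. F s z) holomorphic_on S"
      unfolding F_def by (intro holomorphic_intros c_hol d_hol bcd_hol)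
  next
    fix s and z :: "complex^'n"
    assume "s \<in> S"
    then have s: "((cmod (c s k))\<^sup>2 + (cmod (d s k))\<^sup>2) / 2 + \<delta> \<le> Re (bcd s k)"
      "cmod (c s k) \<le> 2" "cmod (d s k) \<le> 2" for k
      using S(3) by (auto simp: S0_def intro: less_imp_le)
    have n1: "norm (cdiag (c s) z) \<le> 2 * norm z" by (rule norm_cdiag_le) (rule s)
    have n2: "norm (cdiag (\<lambda>k. cnj (d s k)) z) \<le> 2 * norm z" by (rule norm_cdiag_le) (simp add: s)
    have p: "cmod (\<Prod>k\<in>UNIV. c s k * d s k) \<le> 4 ^ CARD('n)"
    proof -
      have "cmod (\<Prod>k\<in>UNIV. c s k * d s k) = (\<Prod>k\<in>UNIV. cmod (c s k) * cmod (d s k))"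
        by (simp add: prod_norm[symmetric] norm_mult)
      also have "\<dots> \<le> (\<Prod>k\<in>(UNIV::'n set). 2 * 2)"
        by (intro prod_mono conjI mult_mono s) auto
      finally show ?thesis by simp
    qed
    have v: "vcnj (\<chi> k. d s k * cnj (z $ k)) = cdiag (\<lambda>k. cnj (d s k)) z"
      by (simp add: vec_eq_iff vcnj_def)
    have hb: "cmod (h (cdiag (c s) z)) \<le> C1 * exp ((norm (cdiag (c s) z))\<^sup>2 / 2 + 2 * norm z)"
      using n1 by (intro order_trans[OF C1(2)] mult_left_mono C1(1)) simp
    have qb: "cmod (q (cdiag (\<lambda>k. cnj (d s k)) z)) \<le> C2 * exp ((norm (cdiag (\<lambda>k. cnj (d s k)) z))\<^sup>2 / 2 + 2 * norm z)"
      using n2 by (intro order_trans[OF C2(2)] mult_left_mono C2(1)) simp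
    have ex: "- (\<Sum>k\<in>UNIV. Re (bcd s k) * (cmod (z $ k))\<^sup>2) + (norm (cdiag (c s) z))\<^sup>2 / 2
        + (norm (cdiag (\<lambda>k. cnj (d s k)) z))\<^sup>2 / 2 \<le> - \<delta> * (norm z)\<^sup>2"
    proof -
      have "(norm (cdiag (c s) z))\<^sup>2 / 2 + (norm (cdiag (\<lambda>k. cnj (d s k)) z))\<^sup>2 / 2 + \<delta> * (norm z)\<^sup>2
        = (\<Sum>k\<in>UNIV. (((cmod (c s k))\<^sup>2 + (cmod (d s k))\<^sup>2) / 2 + \<delta>) * (cmod (z $ k))\<^sup>2)"
        by (simp add: norm_vec_sq norm_mult power_mult_distrib sum_divide_distrib sum_distrib_left
            sum.distrib[symmetric] algebra_simps add_divide_distrib)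
      also have "\<dots> \<le> (\<Sum>k\<in>UNIV. Re (bcd s k) * (cmod (z $ k))\<^sup>2)"
        by (intro sum_mono mult_right_mono s) auto
      finally show ?thesis by simp
    qed
    have "cmod (F s z) = cmod (\<Prod>k\<in>UNIV. c s k * d s k)
        * exp (- (\<Sum>k\<in>UNIV. Re (bcd s k) * (cmod (z $ k))\<^sup>2))
        * (cmod (h (cdiag (c s) z)) * cmod (q (cdiag (\<lambda>k. cnj (d s k)) z)))"
      unfolding F_def v by (simp add: norm_mult norm_exp_eq_Re cdiag_def)
    also have "\<dots> \<le> 4 ^ CARD('n) * exp (- (\<Sum>k\<in>UNIV. Re (bcd s k) * (cmod (z $ k))\<^sup>2))
        * ((C1 * exp ((norm (cdiag (c s) z))\<^sup>2 / 2 + 2 * norm z))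
          * (C2 * exp ((norm (cdiag (\<lambda>k. cnj (d s k)) z))\<^sup>2 / 2 + 2 * norm z)))"
      by (intro mult_mono p hb qb mult_nonneg_nonneg C1 C2) (auto intro: C1 C2)
    also have "\<dots> = 4 ^ CARD('n) * (C1 * C2) * exp (- (\<Sum>k\<in>UNIV. Re (bcd s k) * (cmod (z $ k))\<^sup>2)
         + (norm (cdiag (c s) z))\<^sup>2 / 2 + (norm (cdiag (\<lambda>k. cnj (d s k)) z))\<^sup>2 / 2 + 4 * norm z)"
      by (simp add: mult_exp_exp algebra_simps)
    also have "\<dots> \<le> 4 ^ CARD('n) * (C1 * C2) * exp (4 * norm z - \<delta> * (norm z)\<^sup>2)"
      using ex C1 C2 by (intro mult_left_mono mult_nonneg_nonneg) auto
    finally show "cmod (F s z) \<le> 4 ^ CARD('n) * (C1 * C2) * exp (4 * norm z - \<delta> * (norm z)\<^sup>2)" .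
  qed
  have real: "Q (of_real x) = (\<integral>z. exp (- (\<Sum>k\<in>UNIV. b k * of_real ((cmod (z $ k))\<^sup>2))) * (h z * cnj (q z)) \<partial>lborel)" for x
  proof -
    let ?G = "\<lambda>z. exp (- (\<Sum>k\<in>UNIV. b k * of_real ((cmod (z $ k))\<^sup>2))) * (h z * cnj (q z))"
    have dc: "d (of_real x) k = cnj (c (of_real x) k)" for k
      by (simp add: c_def d_def exp_cnj)
    have "cnj \<in> borel_measurable borel" by (intro borel_measurable_continuous_onI continuous_intros)
    moreover have "(\<lambda>z::complex^'n. exp (- (\<Sum>k\<in>UNIV. b k * of_real ((cmod (z $ k))\<^sup>2)))) \<in> borel_measurable borel"
      by (intro borel_measurable_continuous_onI continuous_intros)
    ultimately have "?G \<in> borel_measurable borel" by measurable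
    from integral_lborel_cdiag[OF _ this, of "c (of_real x)"]
    have "(\<integral>z. ?G z \<partial>lborel) = (\<Prod>k\<in>UNIV. (cmod (c (of_real x) k))\<^sup>2) *\<^sub>R (\<integral>z. ?G (cdiag (c (of_real x)) z) \<partial>lborel)"
      by (simp add: c_def)
    also have "\<dots> = (\<integral>z. (\<Prod>k\<in>UNIV. (cmod (c (of_real x) k))\<^sup>2) *\<^sub>R ?G (cdiag (c (of_real x)) z) \<partial>lborel)"
      by (rule integral_scaleR_right[symmetric])
    also have "\<dots> = Q (of_real x)"
      unfolding Q_def
    proof (rule Bochner_Integration.integral_cong)
      fix z :: "complex^'n"
      have "(\<Prod>k\<in>UNIV. c (of_real x) k * d (of_real x) k) = of_real (\<Prod>k\<in>UNIV. (cmod (c (of_real x) k))\<^sup>2)"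
        by (simp only: dc of_real_prod complex_norm_square)
      moreover have "bcd (of_real x) k * of_real ((cmod (z $ k))\<^sup>2) = b k * of_real ((cmod (cdiag (c (of_real x)) z $ k))\<^sup>2)" for k
        by (simp only: bcd_def dc cdiag_nth norm_mult power_mult_distrib of_real_mult complex_norm_square mult.assoc)
      moreover have "vcnj (\<chi> k. d (of_real x) k * cnj (z $ k)) = cdiag (c (of_real x)) z"
        by (simp add: vec_eq_iff vcnj_def dc)
      ultimately show "(\<Prod>k\<in>UNIV. (cmod (c (of_real x) k))\<^sup>2) *\<^sub>R ?G (cdiag (c (of_real x)) z) = F (of_real x) z"
        unfolding F_def by (simp only: scaleR_conv_of_real cdiag_def mult.assoc)
    qed simp
    finally show ?thesis by simp
  qed
  have "Q \<i> - Q 0 = 0"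
  proof -
    obtain e where e: "e > 0" "cball 0 e \<subseteq> S"
      using S(1) S01(1) open_contains_cball by blast
    have "0 \<noteq> complex_of_real e" using e by simp
    then have "closed_segment 0 (complex_of_real e) \<noteq> {x}" for x
      by (metis ends_in_segment singletonD)
    then have "(0::complex) islimpt closed_segment 0 (of_real e)"
      by (intro connected_imp_perfect) auto
    moreover have "closed_segment 0 (of_real e) \<subseteq> S"
      using e by (intro order_trans[OF _ e(2)] closed_segment_subset) auto
    moreover have "Q w - Q 0 = 0" if w: "w \<in> closed_segment 0 (of_real e)" for w
    proof -
      obtain u :: real where "w = (1 - u) *\<^sub>R 0 + u *\<^sub>R of_real e"
        using w unfolding closed_segment_def by blast
      then have "w = of_real (u * e)" by (simp add: scaleR_conv_of_real)
      then show ?thesis using real[of "u * e"] real[of 0] by simp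
    qed
    moreover have "(\<lambda>s. Q s - Q 0) holomorphic_on S" by (intro holomorphic_intros \<open>Q holomorphic_on S\<close>)
    ultimately show ?thesis
      using analytic_continuation[of "\<lambda>s. Q s - Q 0" S "closed_segment 0 (of_real e)" 0 \<i>] S(1,2) S01 by blast
  qed
  then have "Q 0 = Q \<i>" by simp
  also have "Q \<i> = (\<Prod>k\<in>UNIV. 1 / b k) *
      (\<integral>z. of_real (exp (- (norm z)\<^sup>2)) * (h (cdiag (\<lambda>k. 1 / b k) z) * cnj (q z)) \<partial>lborel)"
  proof -
    have "F \<i> z = (\<Prod>k\<in>UNIV. 1 / b k) * (of_real (exp (- (norm z)\<^sup>2)) * (h (cdiag (\<lambda>k. 1 / b k) z) * cnj (q z)))" for z
    proof -
      have "bcd \<i> k = 1" for k by (simp add: bcd)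
      moreover have "vcnj (\<chi> k. cnj (z $ k)) = z" by (simp add: vec_eq_iff vcnj_def)
      moreover have "exp (- (\<Sum>k\<in>UNIV. complex_of_real ((cmod (z $ k))\<^sup>2))) = of_real (exp (- (norm z)\<^sup>2))"
        by (simp add: norm_vec_sq flip: exp_of_real)
      ultimately show ?thesis unfolding F_def by (simp add: c_i d_i cdiag_def mult.assoc)
    qed
    then have "F \<i> = (\<lambda>z. (\<Prod>k\<in>UNIV. 1 / b k) * (of_real (exp (- (norm z)\<^sup>2)) * (h (cdiag (\<lambda>k. 1 / b k) z) * cnj (q z))))"
      by (rule ext)
    then show ?thesis unfolding Q_def by (simp only: integral_mult_right_zero)
  qed
  finally show ?thesis using real[of 0] by simp
qed

section \<open>Quaternions acting on a coordinate plane\<close>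

text \<open>
  The quaternion \<open>p0 + p1 \<^bold>i + p2 \<^bold>j + p3 \<^bold>k\<close> acts on the plane of the coordinates
  \<open>i, j\<close> through its usual \<open>2 \<times> 2\<close> complex matrix, where
  \<open>\<^bold>i, \<^bold>j, \<^bold>k\<close> become \<open>\<i>\<close> times the Hermitian matrices of the forms
  \<open>X, Y, Z\<close>. The real factor \<open>s\<close> scales all other coordinates.
\<close>

definition quaternion_map :: "'n \<Rightarrow> 'n \<Rightarrow> real \<Rightarrow> real \<Rightarrow> real \<Rightarrow> real \<Rightarrow> real \<Rightarrow> complex^'n \<Rightarrow> complex^'n" where
  "quaternion_map i j s p0 p1 p2 p3 z = (\<chi> k.
     if k = i then Complex p0 p1 * z $ i + Complex p2 p3 * z $ j
     else if k = j then Complex (- p2) p3 * z $ i + Complex p0 (- p1) * z $ j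
     else of_real s * z $ k)"

lemma quaternion_map_nth:
  "i \<noteq> j \<Longrightarrow> quaternion_map i j s p0 p1 p2 p3 z $ i = Complex p0 p1 * z $ i + Complex p2 p3 * z $ j"
  "i \<noteq> j \<Longrightarrow> quaternion_map i j s p0 p1 p2 p3 z $ j = Complex (- p2) p3 * z $ i + Complex p0 (- p1) * z $ j"
  "k \<noteq> i \<Longrightarrow> k \<noteq> j \<Longrightarrow> quaternion_map i j s p0 p1 p2 p3 z $ k = of_real s * z $ k"
  by (simp_all add: quaternion_map_def)

lemma linear_quaternion_map: "linear (quaternion_map i j s p0 p1 p2 p3)"
  by (rule linearI) (auto simp: vec_eq_iff quaternion_map_def algebra_simps)

lemma quaternion_map_scalar: "quaternion_map i j s p0 p1 p2 p3 (c *s v) = c *s quaternion_map i j s p0 p1 p2 p3 v"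
  by (auto simp: vec_eq_iff quaternion_map_def algebra_simps)

lemma quaternion_map_cong:
  "s = s' \<Longrightarrow> p0 = r0 \<Longrightarrow> p1 = r1 \<Longrightarrow> p2 = r2 \<Longrightarrow> p3 = r3 \<Longrightarrow> quaternion_map i j s p0 p1 p2 p3 z = quaternion_map i j s' r0 r1 r2 r3 z"
  by simp

lemma quaternion_map_compose:
  assumes "i \<noteq> j"
  shows "quaternion_map i j s p0 p1 p2 p3 (quaternion_map i j t r0 r1 r2 r3 z) = quaternion_map i j (s * t)
      (p0 * r0 - p1 * r1 - p2 * r2 - p3 * r3) (p0 * r1 + p1 * r0 + p2 * r3 - p3 * r2)
      (p0 * r2 - p1 * r3 + p2 * r0 + p3 * r1) (p0 * r3 + p1 * r2 - p2 * r1 + p3 * r0) z"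
proof -
  have "quaternion_map i j s p0 p1 p2 p3 (quaternion_map i j t r0 r1 r2 r3 z) $ k = quaternion_map i j (s * t)
      (p0 * r0 - p1 * r1 - p2 * r2 - p3 * r3) (p0 * r1 + p1 * r0 + p2 * r3 - p3 * r2)
      (p0 * r2 - p1 * r3 + p2 * r0 + p3 * r1) (p0 * r3 + p1 * r2 - p2 * r1 + p3 * r0) z $ k" for k
  proof -
    consider "k = i" | "k = j" | "k \<noteq> i" "k \<noteq> j" by blast
    then show ?thesis
      by cases (simp_all add: quaternion_map_nth assms complex_eq_iff algebra_simps)
  qed
  then show ?thesis by (simp add: vec_eq_iff)
qed

lemma quaternion_map_one: "i \<noteq> j \<Longrightarrow> quaternion_map i j 1 1 0 0 0 z = z"
  by (auto simp: vec_eq_iff quaternion_map_def complex_eq_iff)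

text \<open>
  Conjugation by a unit quaternion rotates the imaginary axis \<open>\<^bold>i\<close> to the unit vector
  with the coordinates \<open>2 p0\<^sup>2 - 1\<close>, \<open>2 p0 p3\<close>, \<open>- 2 p0 p2\<close>.
\<close>

lemma quaternion_map_conjugate:
  assumes ij: "i \<noteq> j" and p: "p0\<^sup>2 + p2\<^sup>2 + p3\<^sup>2 = 1"
  shows "quaternion_map i j 1 p0 0 p2 p3 (quaternion_map i j s a b 0 0 (quaternion_map i j 1 p0 0 (- p2) (- p3) z))
    = quaternion_map i j s a (b * (2 * p0\<^sup>2 - 1)) (b * (2 * p0 * p3)) (b * (- 2 * p0 * p2)) z"
  unfolding quaternion_map_compose[OF ij]
proof (rule quaternion_map_cong, goal_cases)
  case 2
  have "a * (p0\<^sup>2 + p2\<^sup>2 + p3\<^sup>2) = a" by (simp add: p)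
  then show ?case by (simp add: power2_eq_square algebra_simps)
next
  case 3
  have "b * (2 * p0\<^sup>2 - 1) = b * (p0\<^sup>2 - p2\<^sup>2 - p3\<^sup>2)" using p by simp
  then show ?case by (simp add: power2_eq_square algebra_simps)
qed (simp_all add: algebra_simps)

lemma sum_split_pair:
  fixes F :: "'n::finite \<Rightarrow> 'a::comm_monoid_add"
  assumes "i \<noteq> j"
  shows "(\<Sum>k\<in>UNIV. F k) = F i + F j + (\<Sum>k\<in>UNIV - {i, j}. F k)"
proof -
  have "(\<Sum>k\<in>UNIV. F k) = (\<Sum>k\<in>insert i (insert j (UNIV - {i, j})). F k)"
    by (rule sum.cong) auto
  then show ?thesis using assms by (simp add: add.assoc)
qed

lemma norm_quaternion_map:
  assumes ij: "i \<noteq> j"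
  shows "(norm (quaternion_map i j s p0 p1 p2 p3 z))\<^sup>2 = (p0\<^sup>2 + p1\<^sup>2 + p2\<^sup>2 + p3\<^sup>2) * ((cmod (z $ i))\<^sup>2 + (cmod (z $ j))\<^sup>2)
      + s\<^sup>2 * (\<Sum>k\<in>UNIV - {i, j}. (cmod (z $ k))\<^sup>2)"
proof -
  have "(cmod (quaternion_map i j s p0 p1 p2 p3 z $ i))\<^sup>2 + (cmod (quaternion_map i j s p0 p1 p2 p3 z $ j))\<^sup>2
      = (p0\<^sup>2 + p1\<^sup>2 + p2\<^sup>2 + p3\<^sup>2) * ((cmod (z $ i))\<^sup>2 + (cmod (z $ j))\<^sup>2)"
    unfolding quaternion_map_nth(1,2)[OF ij] cmod_power2 by (simp add: power2_eq_square algebra_simps)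
  moreover have "(\<Sum>k\<in>UNIV - {i, j}. (cmod (quaternion_map i j s p0 p1 p2 p3 z $ k))\<^sup>2)
      = s\<^sup>2 * (\<Sum>k\<in>UNIV - {i, j}. (cmod (z $ k))\<^sup>2)"
    by (simp add: quaternion_map_nth norm_mult power_mult_distrib sum_distrib_left)
  ultimately show ?thesis unfolding norm_vec_sq sum_split_pair[OF ij] by simp
qed

lemma norm_quaternion_map_le:
  assumes ij: "i \<noteq> j" and R: "R \<ge> 0" "p0\<^sup>2 + p1\<^sup>2 + p2\<^sup>2 + p3\<^sup>2 \<le> R\<^sup>2" "s\<^sup>2 \<le> R\<^sup>2"
  shows "norm (quaternion_map i j s p0 p1 p2 p3 z) \<le> R * norm z"
proof -
  have "(norm (quaternion_map i j s p0 p1 p2 p3 z))\<^sup>2 \<le> R\<^sup>2 * ((cmod (z $ i))\<^sup>2 + (cmod (z $ j))\<^sup>2)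
      + R\<^sup>2 * (\<Sum>k\<in>UNIV - {i, j}. (cmod (z $ k))\<^sup>2)"
    unfolding norm_quaternion_map[OF ij] by (intro add_mono mult_right_mono R sum_nonneg) auto
  also have "\<dots> = (R * norm z)\<^sup>2"
    by (simp add: norm_vec_sq sum_split_pair[OF ij] power_mult_distrib distrib_left)
  finally show ?thesis using R by (meson mult_nonneg_nonneg norm_ge_zero power2_le_imp_le)
qed

lemma norm_quaternion_map_unit:
  assumes ij: "i \<noteq> j" and "p0\<^sup>2 + p1\<^sup>2 + p2\<^sup>2 + p3\<^sup>2 = 1"
  shows "norm (quaternion_map i j 1 p0 p1 p2 p3 z) = norm z"
proof -
  have "(norm (quaternion_map i j 1 p0 p1 p2 p3 z))\<^sup>2 = (norm z)\<^sup>2"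
    unfolding norm_quaternion_map[OF ij] assms(2) by (simp add: norm_vec_sq sum_split_pair[OF ij])
  then show ?thesis by simp
qed

text \<open>
  The map from the plane to \<open>(X, Y, Z)\<close> is the Hopf map, so a quaternion induces a
  rotation of these three real coordinates, scaled by its squared length. Here \<open>p1 = 0\<close>.
\<close>

lemma coords_rotate:
  assumes ij: "i \<noteq> j"
  shows "coord_X i j (quaternion_map i j 1 p0 0 p2 p3 z)
      = (p0\<^sup>2 - p2\<^sup>2 - p3\<^sup>2) * coord_X i j z - 2 * p0 * p3 * coord_Y i j z + 2 * p0 * p2 * coord_Z i j z"
    and "coord_Y i j (quaternion_map i j 1 p0 0 p2 p3 z)
      = 2 * p0 * p3 * coord_X i j z + (p0\<^sup>2 + p2\<^sup>2 - p3\<^sup>2) * coord_Y i j z + 2 * p2 * p3 * coord_Z i j z"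
    and "coord_Z i j (quaternion_map i j 1 p0 0 p2 p3 z)
      = - 2 * p0 * p2 * coord_X i j z + 2 * p2 * p3 * coord_Y i j z + (p0\<^sup>2 - p2\<^sup>2 + p3\<^sup>2) * coord_Z i j z"
  unfolding coord_X_def coord_Y_def coord_Z_def quaternion_map_nth(1,2)[OF ij] cmod_power2
  by (simp_all add: power2_eq_square algebra_simps)

lemma rotated_coords:
  assumes ij: "i \<noteq> j" and p: "p0\<^sup>2 + p2\<^sup>2 + p3\<^sup>2 = 1"
    and n: "x = 2 * p0\<^sup>2 - 1" "y = 2 * p0 * p3" "w = - 2 * p0 * p2"
  shows "x * coord_X i j (quaternion_map i j 1 p0 0 p2 p3 z) + y * coord_Y i j (quaternion_map i j 1 p0 0 p2 p3 z)
      + w * coord_Z i j (quaternion_map i j 1 p0 0 p2 p3 z) = coord_X i j z"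
proof -
  have x: "x = p0\<^sup>2 - p2\<^sup>2 - p3\<^sup>2" using n(1) p by simp
  have "x * coord_X i j (quaternion_map i j 1 p0 0 p2 p3 z) + y * coord_Y i j (quaternion_map i j 1 p0 0 p2 p3 z)
      + w * coord_Z i j (quaternion_map i j 1 p0 0 p2 p3 z) = (p0\<^sup>2 + p2\<^sup>2 + p3\<^sup>2)\<^sup>2 * coord_X i j z"
    unfolding coords_rotate[OF ij] x n(2,3) by (simp add: power2_eq_square algebra_simps)
  then show ?thesis using p by simp
qed

text \<open>
  The unit quaternions with \<open>p1 = 0\<close> already rotate \<open>\<^bold>i\<close> to every point of the sphere;
  the half-angle formula gives \<open>p0\<close>, except at the antipode, where \<open>p0 = 0\<close>.
\<close>

lemma unit_vector_parametrization:
  fixes x y w :: real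
  assumes "x\<^sup>2 + y\<^sup>2 + w\<^sup>2 = 1"
  obtains p0 p2 p3 where "p0\<^sup>2 + p2\<^sup>2 + p3\<^sup>2 = 1" "x = 2 * p0\<^sup>2 - 1" "y = 2 * p0 * p3" "w = - 2 * p0 * p2"
proof (cases "x = - 1")
  case True
  then have "y = 0" "w = 0" using assms by (auto simp: sum_power2_eq_zero_iff)
  then show ?thesis using that[of 0 1 0] True by simp
next
  case False
  have "x\<^sup>2 \<le> 1\<^sup>2" using assms by (smt (verit) one_power2 zero_le_power2)
  then have "- 1 \<le> x" using abs_le_square_iff[of x 1] by simp
  then have x: "1 + x > 0" using False by simp
  define p0 where "p0 = sqrt ((1 + x) / 2)"
  have p0: "p0\<^sup>2 = (1 + x) / 2" "p0 \<noteq> 0" using x by (auto simp: p0_def)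
  show ?thesis
  proof (rule that[of p0 "- w / (2 * p0)" "y / (2 * p0)"])
    have "p0\<^sup>2 + (- w / (2 * p0))\<^sup>2 + (y / (2 * p0))\<^sup>2 = p0\<^sup>2 + (w\<^sup>2 + y\<^sup>2) / (4 * p0\<^sup>2)"
      by (simp add: power_divide power_mult_distrib add_divide_distrib)
    also have "w\<^sup>2 + y\<^sup>2 = (1 + x) * (1 - x)"
      using assms by (simp add: power2_eq_square algebra_simps)
    also have "p0\<^sup>2 + (1 + x) * (1 - x) / (4 * p0\<^sup>2) = 1"
      unfolding p0(1) using x by (simp add: field_simps)
    finally show "p0\<^sup>2 + (- w / (2 * p0))\<^sup>2 + (y / (2 * p0))\<^sup>2 = 1" .
  qed (use p0 in \<open>auto simp: field_simps\<close>)
qed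

section \<open>Toeplitz operators of exponential symbols\<close>

definition exp_symbol :: "'n::finite \<Rightarrow> 'n \<Rightarrow> real \<Rightarrow> real \<Rightarrow> real \<Rightarrow> complex^'n \<Rightarrow> complex" where
  "exp_symbol i j x y w z = exp (of_real (- (norm z)\<^sup>2)
     + \<i> * of_real (x * coord_X i j z + y * coord_Y i j z + w * coord_Z i j z))"

lemma continuous_coords:
  "continuous_on A (coord_X i j)" "continuous_on A (coord_Y i j)" "continuous_on A (coord_Z i j)"
  unfolding coord_X_def[abs_def] coord_Y_def[abs_def] coord_Z_def[abs_def]
  by (intro continuous_intros)+

lemma continuous_exp_symbol: "continuous_on A (exp_symbol i j x y w)"
  unfolding exp_symbol_def[abs_def] by (intro continuous_intros continuous_coords)

lemma exp_symbol_measurable [measurable]: "exp_symbol i j x y w \<in> borel_measurable borel"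
  by (rule borel_measurable_continuous_onI[OF continuous_exp_symbol])

lemma cmod_exp_symbol: "cmod (exp_symbol i j x y w z) = exp (- (norm z)\<^sup>2)"
  by (simp add: exp_symbol_def norm_exp_eq_Re)

text \<open>
  The eigenvalues of \<open>I + A\<close> for an exponential symbol with parameter vector of length \<open>c\<close>.
\<close>

definition exp_symbol_eigenvalue :: "'n \<Rightarrow> 'n \<Rightarrow> real \<Rightarrow> 'n \<Rightarrow> complex" where
  "exp_symbol_eigenvalue i j c k = (if k = i then Complex 2 (- c) else if k = j then Complex 2 c else 2)"

definition exp_symbol_inverse_det :: "'n::finite \<Rightarrow> 'n \<Rightarrow> real \<Rightarrow> complex" where
  "exp_symbol_inverse_det i j c = (\<Prod>k\<in>UNIV. 1 / exp_symbol_eigenvalue i j c k)"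

lemma exp_symbol_inverse_det_nonzero: "exp_symbol_inverse_det i j c \<noteq> 0"
proof -
  have "exp_symbol_eigenvalue i j c k \<noteq> 0" for k by (simp add: exp_symbol_eigenvalue_def complex_eq_iff)
  then show ?thesis by (simp add: exp_symbol_inverse_det_def)
qed

lemma cdiag_exp_symbol_eigenvalue:
  fixes i j :: "'n::finite"
  assumes "i \<noteq> j"
  shows "cdiag (\<lambda>k. 1 / exp_symbol_eigenvalue i j c k) = quaternion_map i j (1 / 2) (2 / (4 + c\<^sup>2)) (c / (4 + c\<^sup>2)) 0 0"
proof (rule ext)
  fix z :: "complex^'n"
  have inv: "1 / Complex 2 (- c) = Complex (2 / (4 + c\<^sup>2)) (c / (4 + c\<^sup>2))"
    "1 / Complex 2 c = Complex (2 / (4 + c\<^sup>2)) (- (c / (4 + c\<^sup>2)))"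
    by (simp_all add: complex_eq_iff Re_divide Im_divide)
  have inv': "v / Complex 2 (- c) = Complex (2 / (4 + c\<^sup>2)) (c / (4 + c\<^sup>2)) * v"
    "v / Complex 2 c = Complex (2 / (4 + c\<^sup>2)) (- (c / (4 + c\<^sup>2))) * v" for v
    by (simp_all flip: inv)
  have zero: "Complex 0 0 = 0" by (simp add: complex_eq_iff)
  show "cdiag (\<lambda>k. 1 / exp_symbol_eigenvalue i j c k) z = quaternion_map i j (1 / 2) (2 / (4 + c\<^sup>2)) (c / (4 + c\<^sup>2)) 0 0 z"
    using assms by (auto simp: vec_eq_iff exp_symbol_eigenvalue_def quaternion_map_def inv' zero)
qed

text \<open>
  A unitary change of variables turns the parameter vector \<open>(x, y, w)\<close> into
  \<open>(c, 0, 0)\<close> and thus makes the Gaussian diagonal, with one eigenvalue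
  \<open>2 - \<i> c\<close>, one \<open>2 + \<i> c\<close>, and all others \<open>2\<close>. Undoing it afterwards conjugates the
  diagonal inverse back to \<open>(I + A)\<^sup>-\<^sup>1\<close>.
\<close>

lemma exp_symbol_integral_identity:
  fixes h q :: "complex^'n \<Rightarrow> complex"
  assumes ij: "i \<noteq> j" and h: "h \<in> fock_space" and q: "q \<in> fock_space"
    and N: "N = 4 + x\<^sup>2 + y\<^sup>2 + w\<^sup>2"
  shows "(\<integral>z. of_real (exp (- (norm z)\<^sup>2)) * (exp_symbol i j x y w z * h z * cnj (q z)) \<partial>lborel)
    = exp_symbol_inverse_det i j (sqrt (x\<^sup>2 + y\<^sup>2 + w\<^sup>2)) *
      (\<integral>z. of_real (exp (- (norm z)\<^sup>2)) * (h (quaternion_map i j (1 / 2) (2 / N) (x / N) (y / N) (w / N) z) * cnj (q z)) \<partial>lborel)"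
proof -
  define c where "c = sqrt (x\<^sup>2 + y\<^sup>2 + w\<^sup>2)"
  have c2: "c\<^sup>2 = x\<^sup>2 + y\<^sup>2 + w\<^sup>2" by (simp add: c_def)
  obtain nx ny nw where n: "nx\<^sup>2 + ny\<^sup>2 + nw\<^sup>2 = 1" "x = c * nx" "y = c * ny" "w = c * nw"
  proof (cases "c = 0")
    case True
    then have "x = 0 \<and> y = 0 \<and> w = 0" using c2 by (simp add: add_nonneg_eq_0_iff)
    then show ?thesis using that[of 1 0 0] True by simp
  next
    case False
    then have "(x / c)\<^sup>2 + (y / c)\<^sup>2 + (w / c)\<^sup>2 = 1"
      by (simp add: power_divide add_divide_distrib[symmetric] c2[symmetric])
    then show ?thesis using that[of "x / c" "y / c" "w / c"] False by simp
  qed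
  obtain p0 p2 p3 where p: "p0\<^sup>2 + p2\<^sup>2 + p3\<^sup>2 = 1" "nx = 2 * p0\<^sup>2 - 1" "ny = 2 * p0 * p3" "nw = - 2 * p0 * p2"
    using unit_vector_parametrization[OF n(1)] by blast
  define V where "V = quaternion_map i j 1 p0 0 p2 p3"
  define V' where "V' = quaternion_map i j 1 p0 0 (- p2) (- p3)"
  have V: "linear V" "norm (V z) = norm z" "V (a *s v) = a *s V v" for z a v
    using norm_quaternion_map_unit[OF ij, of p0 0 p2 p3 z] p(1) linear_quaternion_map quaternion_map_scalar by (auto simp: V_def)
  have V': "linear V'" "norm (V' z) = norm z" for z
    using norm_quaternion_map_unit[OF ij, of p0 0 "- p2" "- p3" z] p(1) linear_quaternion_map by (auto simp: V'_def)
  have VV': "V (V' z) = z" for z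
  proof -
    have "p0 * p0 + p2 * p2 + p3 * p3 = 1" using p(1) by (simp add: power2_eq_square)
    then show ?thesis using quaternion_map_one[OF ij] by (simp add: V_def V'_def quaternion_map_compose[OF ij] algebra_simps)
  qed
  have VDV': "V (cdiag (\<lambda>k. 1 / exp_symbol_eigenvalue i j c k) (V' z)) = quaternion_map i j (1 / 2) (2 / N) (x / N) (y / N) (w / N) z" for z
  proof -
    have N': "4 + c\<^sup>2 = N" using N c2 by simp
    show ?thesis
      unfolding cdiag_exp_symbol_eigenvalue[OF ij] V_def V'_def quaternion_map_conjugate[OF ij p(1)] N' n(2,3,4) p(2,3,4)
      by (simp only: times_divide_eq_left)
  qed
  have [measurable]: "cnj \<in> borel_measurable borel" by (intro borel_measurable_continuous_onI continuous_intros)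
  have [measurable]: "h \<in> borel_measurable borel" "q \<in> borel_measurable borel"
    using h q by (auto simp: fock_space_iff entire_measurable)
  have "(\<integral>z. of_real (exp (- (norm z)\<^sup>2)) * (exp_symbol i j x y w z * h z * cnj (q z)) \<partial>lborel)
      = (\<integral>z. of_real (exp (- (norm (V z))\<^sup>2)) * (exp_symbol i j x y w (V z) * h (V z) * cnj (q (V z))) \<partial>lborel)"
    by (rule integral_lborel_isometry[OF V(1,2), symmetric]) measurable
  also have "\<dots> = (\<integral>z. exp (- (\<Sum>k\<in>UNIV. exp_symbol_eigenvalue i j c k * of_real ((cmod (z $ k))\<^sup>2))) * (h (V z) * cnj (q (V z))) \<partial>lborel)"
  proof (rule Bochner_Integration.integral_cong)
    fix z :: "complex^'n"
    have "x * coord_X i j (V z) + y * coord_Y i j (V z) + w * coord_Z i j (V z) = c * coord_X i j z"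
      using rotated_coords[OF ij p(1,2,3,4), of z, folded V_def] unfolding n(2,3,4)
      by (metis (no_types, opaque_lifting) distrib_left mult.assoc)
    then have "of_real (exp (- (norm (V z))\<^sup>2)) * exp_symbol i j x y w (V z)
        = exp (of_real (- (norm z)\<^sup>2) + (of_real (- (norm z)\<^sup>2) + \<i> * of_real (c * coord_X i j z)))"
      unfolding exp_symbol_def V(2) exp_of_real[symmetric] mult_exp_exp by simp
    also have "of_real (- (norm z)\<^sup>2) + (of_real (- (norm z)\<^sup>2) + \<i> * of_real (c * coord_X i j z))
        = - (\<Sum>k\<in>UNIV. exp_symbol_eigenvalue i j c k * of_real ((cmod (z $ k))\<^sup>2))"
    proof -
      have "(\<Sum>k\<in>UNIV - {i, j}. exp_symbol_eigenvalue i j c k * of_real ((cmod (z $ k))\<^sup>2))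
          = (\<Sum>k\<in>UNIV - {i, j}. 2 * of_real ((cmod (z $ k))\<^sup>2))"
        by (rule sum.cong) (auto simp: exp_symbol_eigenvalue_def)
      then show ?thesis
        unfolding norm_vec_sq sum_split_pair[OF ij] coord_X_def using ij
        by (simp add: exp_symbol_eigenvalue_def complex_eq_iff sum_distrib_left algebra_simps)
    qed
    finally show "of_real (exp (- (norm (V z))\<^sup>2)) * (exp_symbol i j x y w (V z) * h (V z) * cnj (q (V z)))
      = exp (- (\<Sum>k\<in>UNIV. exp_symbol_eigenvalue i j c k * of_real ((cmod (z $ k))\<^sup>2))) * (h (V z) * cnj (q (V z)))"
      by (simp add: mult.assoc)
  qed simp
  also have "\<dots> = exp_symbol_inverse_det i j c *
      (\<integral>z. of_real (exp (- (norm z)\<^sup>2)) * (h (V (cdiag (\<lambda>k. 1 / exp_symbol_eigenvalue i j c k) z)) * cnj (q (V z))) \<partial>lborel)"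
    unfolding exp_symbol_inverse_det_def
    by (rule gaussian_diag_identity[OF fock_space_isometry[OF h V] fock_space_isometry[OF q V]])
      (simp add: exp_symbol_eigenvalue_def)
  also have "(\<integral>z. of_real (exp (- (norm z)\<^sup>2)) * (h (V (cdiag (\<lambda>k. 1 / exp_symbol_eigenvalue i j c k) z)) * cnj (q (V z))) \<partial>lborel)
      = (\<integral>z. of_real (exp (- (norm (V' z))\<^sup>2)) * (h (V (cdiag (\<lambda>k. 1 / exp_symbol_eigenvalue i j c k) (V' z))) * cnj (q (V (V' z)))) \<partial>lborel)"
  proof (rule integral_lborel_isometry[OF V', symmetric])
    note [measurable] = linear_borel_measurable[OF V(1)] linear_borel_measurable[OF linear_cdiag]
    show "(\<lambda>z. of_real (exp (- (norm z)\<^sup>2)) * (h (V (cdiag (\<lambda>k. 1 / exp_symbol_eigenvalue i j c k) z)) * cnj (q (V z)))) \<in> borel_measurable borel"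
      by measurable
  qed
  finally show ?thesis unfolding V'(2) VV' VDV' unfolding c_def .
qed

text \<open>
  The characterisation of \<open>k = T_\<phi> h\<close> by inner products. Unlike the description by a unique
  choice, it is visibly linear in \<open>\<phi>\<close> and \<open>k\<close>.
\<close>

definition toeplitz_value :: "(complex^'n \<Rightarrow> complex) \<Rightarrow> (complex^'n \<Rightarrow> complex) \<Rightarrow> (complex^'n \<Rightarrow> complex) \<Rightarrow> bool" where
  "toeplitz_value \<phi> h k \<longleftrightarrow> (\<lambda>z. \<phi> z * h z) \<in> gauss_L2 \<and> k \<in> fock_space \<and>
     (\<forall>q\<in>fock_space. gauss_inner (\<lambda>z. \<phi> z * h z) q = gauss_inner k q)"

lemma toeplitz_eq: "toeplitz_value \<phi> h k \<Longrightarrow> toeplitz \<phi> h = k"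
  unfolding toeplitz_value_def toeplitz_def by (intro fock_proj_eqI) auto

lemma toeplitz_value_add:
  assumes "toeplitz_value \<phi> h k" "toeplitz_value \<psi> h l"
  shows "toeplitz_value (\<lambda>z. \<phi> z + \<psi> z) h (\<lambda>z. k z + l z)"
  using assms unfolding toeplitz_value_def distrib_right
  by (auto simp: gauss_inner_add gauss_L2_add fock_space_iff entire_add)

lemma toeplitz_value_cmult:
  assumes "toeplitz_value \<phi> h k"
  shows "toeplitz_value (\<lambda>z. a * \<phi> z) h (\<lambda>z. a * k z)"
  using assms unfolding toeplitz_value_def mult.assoc
  by (auto simp: gauss_inner_cmult gauss_L2_cmult fock_space_iff entire_cmult)

text \<open>
  The matrix is a contraction by a factor of at least two, since
  \<open>(2\<^sup>2 + x\<^sup>2 + y\<^sup>2 + w\<^sup>2) / N\<^sup>2 = 1 / N \<le> 1 / 4\<close>. With the growth bound this keeps the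
  composed function in the Fock space.
\<close>

lemma toeplitz_value_exp_symbol:
  fixes h :: "complex^'n \<Rightarrow> complex"
  assumes ij: "i \<noteq> j" and h: "h \<in> fock_space" and N: "N = 4 + x\<^sup>2 + y\<^sup>2 + w\<^sup>2"
  shows "toeplitz_value (exp_symbol i j x y w) h
    (\<lambda>z. exp_symbol_inverse_det i j (sqrt (x\<^sup>2 + y\<^sup>2 + w\<^sup>2)) * h (quaternion_map i j (1 / 2) (2 / N) (x / N) (y / N) (w / N) z))"
proof -
  let ?A = "quaternion_map i j (1 / 2) (2 / N) (x / N) (y / N) (w / N)"
  let ?K = "exp_symbol_inverse_det i j (sqrt (x\<^sup>2 + y\<^sup>2 + w\<^sup>2))"
  have N4: "N \<ge> 4" by (simp add: N)
  have "norm (?A z) \<le> 1 / 2 * norm z" for z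
  proof (rule norm_quaternion_map_le[OF ij])
    have "(2 / N)\<^sup>2 + (x / N)\<^sup>2 + (y / N)\<^sup>2 + (w / N)\<^sup>2 = N / N\<^sup>2"
      by (simp add: power_divide N add_divide_distrib[symmetric])
    also have "\<dots> = 1 / N" using N4 by (simp add: power2_eq_square)
    also have "\<dots> \<le> (1 / 2)\<^sup>2" using N4 by (simp add: power_divide field_simps)
    finally show "(2 / N)\<^sup>2 + (x / N)\<^sup>2 + (y / N)\<^sup>2 + (w / N)\<^sup>2 \<le> (1 / 2)\<^sup>2" .
  qed auto
  then have k0: "(\<lambda>z. h (?A z)) \<in> fock_space"
    by (intro fock_space_contraction[OF h linear_quaternion_map quaternion_map_scalar]) simp
  then have k: "(\<lambda>z. ?K * h (?A z)) \<in> fock_space"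
    by (simp add: fock_space_iff entire_cmult gauss_L2_cmult)
  have [measurable]: "h \<in> borel_measurable borel"
    using h by (auto simp: fock_space_iff entire_measurable)
  have [measurable]: "cnj \<in> borel_measurable borel" by (intro borel_measurable_continuous_onI continuous_intros)
  have L2: "(\<lambda>z. exp_symbol i j x y w z * h z) \<in> gauss_L2"
  proof -
    have "integrable lborel (\<lambda>z. exp (- (norm z)\<^sup>2) * (cmod (exp_symbol i j x y w z * h z))\<^sup>2)"
    proof (rule Bochner_Integration.integrable_bound)
      show "integrable lborel (\<lambda>z. exp (- (norm z)\<^sup>2) * (cmod (h z))\<^sup>2)"
        using h gauss_L2_iff[of h] by (simp add: fock_space_iff entire_measurable)
      have "(cmod (exp_symbol i j x y w z * h z))\<^sup>2 \<le> (cmod (h z))\<^sup>2" for z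
        by (intro power_mono) (simp_all add: norm_mult cmod_exp_symbol mult_left_le_one_le)
      then show "AE z in lborel. norm (exp (- (norm z)\<^sup>2) * (cmod (exp_symbol i j x y w z * h z))\<^sup>2)
          \<le> norm (exp (- (norm z)\<^sup>2) * (cmod (h z))\<^sup>2)"
        by auto
    qed measurable
    then show ?thesis by (subst gauss_L2_iff) auto
  qed
  have "gauss_inner (\<lambda>z. exp_symbol i j x y w z * h z) q = gauss_inner (\<lambda>z. ?K * h (?A z)) q" if q: "q \<in> fock_space" for q
  proof -
    have [measurable]: "q \<in> borel_measurable borel" "(\<lambda>z. h (?A z)) \<in> borel_measurable borel"
      using q k0 by (auto simp: fock_space_iff entire_measurable)
    show ?thesis
      unfolding gauss_inner_cmult unfolding gauss_inner_def
      by (subst (1 2) integral_gauss) (use exp_symbol_integral_identity[OF ij h q N] in \<open>auto simp: scaleR_conv_of_real mult.assoc\<close>)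
  qed
  then show ?thesis using k L2 by (simp add: toeplitz_value_def)
qed

section \<open>Polynomials times Gaussians are Schwartz functions\<close>

text \<open>
  The span of all products of a polynomial in the real coordinates and a function
  \<open>exp (- \<bar>x\<bar>\<^sup>2 + \<i> B x x)\<close> with a real quadratic form. It is stable under partial derivatives
  and under multiplication by monomials, so the Schwartz estimates reduce to boundedness of its
  members.
\<close>

inductive_set gaussian_span :: "('a::euclidean_space \<Rightarrow> complex) set" where
  gaussian: "bilinear B \<Longrightarrow> (\<lambda>x. exp (of_real (- (norm x)\<^sup>2) + \<i> * of_real (B x x))) \<in> gaussian_span"
| coord: "u \<in> gaussian_span \<Longrightarrow> (\<lambda>x. of_real (x \<bullet> e) * u x) \<in> gaussian_span"
| cmult: "u \<in> gaussian_span \<Longrightarrow> (\<lambda>x. a * u x) \<in> gaussian_span"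
| add: "u \<in> gaussian_span \<Longrightarrow> v \<in> gaussian_span \<Longrightarrow> (\<lambda>x. u x + v x) \<in> gaussian_span"

lemma gaussian_span_linear_mult:
  assumes u: "u \<in> gaussian_span" and L: "linear L"
  shows "(\<lambda>x. L x * u x) \<in> gaussian_span"
proof -
  have "(\<lambda>x. (\<Sum>e\<in>A. L e * (of_real (x \<bullet> e) * u x)) ) \<in> gaussian_span" if "finite A" for A
    using that
  proof (induction A)
    case empty
    then show ?case using gaussian_span.cmult[OF u, of 0] by simp
  next
    case (insert e A)
    then show ?case
      using gaussian_span.add[OF gaussian_span.cmult[OF gaussian_span.coord[OF u]] insert.IH] by simp
  qed
  from this[OF finite_Basis]
  have "(\<lambda>x. (\<Sum>e\<in>Basis. L e * (of_real (x \<bullet> e) * u x))) \<in> gaussian_span" .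
  moreover have "(\<Sum>e\<in>Basis. L e * (of_real (x \<bullet> e) * u x)) = L x * u x" for x
  proof -
    have "L x = L (\<Sum>e\<in>Basis. (x \<bullet> e) *\<^sub>R e)" by (simp add: euclidean_representation)
    also have "\<dots> = (\<Sum>e\<in>Basis. (x \<bullet> e) *\<^sub>R L e)"
      by (simp add: linear_sum[OF L] linear_scale[OF L])
    finally show ?thesis by (simp only: sum_distrib_left sum_distrib_right scaleR_conv_of_real mult_ac)
  qed
  ultimately show ?thesis by simp
qed

lemma gaussian_span_derivative:
  assumes "u \<in> gaussian_span"
  shows "\<exists>v\<in>gaussian_span. \<forall>x. ((\<lambda>t. u (x + t *\<^sub>R e)) has_vector_derivative v x) (at 0)"
  using assms
proof induction
  case (gaussian B)
  define E where "E x = complex_of_real (- (norm x)\<^sup>2) + \<i> * of_real (B x x)" for x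
  define L where "L x = complex_of_real (- 2 * (x \<bullet> e)) + \<i> * of_real (B x e + B e x)" for x
  note B = gaussian
  have "linear L"
    unfolding L_def
    by (rule linearI) (simp_all add: bilinear_ladd[OF B] bilinear_radd[OF B] bilinear_lmul[OF B] bilinear_rmul[OF B]
        inner_add_left algebra_simps scaleR_conv_of_real)
  then have "(\<lambda>x. L x * exp (E x)) \<in> gaussian_span"
    unfolding E_def by (intro gaussian_span_linear_mult gaussian_span.gaussian B)
  moreover have "((\<lambda>t. exp (E (x + t *\<^sub>R e))) has_vector_derivative L x * exp (E x)) (at 0)" for x
  proof -
    have nm: "(norm (x + t *\<^sub>R e))\<^sup>2 = (norm x)\<^sup>2 + t * (2 * (x \<bullet> e)) + t\<^sup>2 * (norm e)\<^sup>2" for t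
      unfolding power2_norm_eq_inner
      by (simp add: inner_add_left inner_add_right inner_commute[of e x] power2_eq_square algebra_simps)
    have eq: "E (x + t *\<^sub>R e) = E x + of_real t * L x + (of_real t)\<^sup>2 * E e" for t
      unfolding E_def L_def nm
      by (simp add: bilinear_ladd[OF B] bilinear_radd[OF B] bilinear_lmul[OF B] bilinear_rmul[OF B]
          power2_eq_square algebra_simps)
    have "((\<lambda>s. exp (E x + s * L x + s\<^sup>2 * E e)) has_field_derivative L x * exp (E x)) (at (of_real 0))"
      by (rule derivative_eq_intros refl | simp)+
    from has_vector_derivative_real_field[OF this] show ?thesis unfolding eq by simp
  qed
  ultimately show ?case unfolding E_def by (intro bexI allI)
next
  case (coord u f)
  then obtain v where v: "v \<in> gaussian_span" "\<And>x. ((\<lambda>t. u (x + t *\<^sub>R e)) has_vector_derivative v x) (at 0)"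
    by blast
  have "(\<lambda>x. of_real (e \<bullet> f) * u x + of_real (x \<bullet> f) * v x) \<in> gaussian_span"
    using gaussian_span.add[OF gaussian_span.cmult[OF coord(1)] gaussian_span.coord[OF v(1)]] .
  moreover have "((\<lambda>t. of_real ((x + t *\<^sub>R e) \<bullet> f) * u (x + t *\<^sub>R e))
      has_vector_derivative of_real (e \<bullet> f) * u x + of_real (x \<bullet> f) * v x) (at 0)" for x
  proof -
    have "((\<lambda>t. complex_of_real ((x + t *\<^sub>R e) \<bullet> f)) has_vector_derivative of_real (e \<bullet> f)) (at 0)"
      by (rule has_vector_derivative_of_real)
        (auto intro!: derivative_eq_intros simp: inner_add_left has_real_derivative_iff_has_vector_derivative[symmetric])
    from has_vector_derivative_mult[OF this v(2)[of x]] show ?thesis by (simp add: add.commute)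
  qed
  ultimately show ?case by (intro bexI allI)
next
  case (cmult u a)
  then obtain v where v: "v \<in> gaussian_span" "\<And>x. ((\<lambda>t. u (x + t *\<^sub>R e)) has_vector_derivative v x) (at 0)"
    by blast
  then have "((\<lambda>t. a * u (x + t *\<^sub>R e)) has_vector_derivative a * v x) (at 0)" for x
    by (intro has_vector_derivative_mult_right)
  then show ?case using gaussian_span.cmult[OF v(1), of a] by (intro bexI allI)
next
  case (add u1 u2)
  then obtain v1 v2 where v: "v1 \<in> gaussian_span" "\<And>x. ((\<lambda>t. u1 (x + t *\<^sub>R e)) has_vector_derivative v1 x) (at 0)"
    "v2 \<in> gaussian_span" "\<And>x. ((\<lambda>t. u2 (x + t *\<^sub>R e)) has_vector_derivative v2 x) (at 0)"
    by blast
  then have "((\<lambda>t. u1 (x + t *\<^sub>R e) + u2 (x + t *\<^sub>R e)) has_vector_derivative v1 x + v2 x) (at 0)" for x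
    by (intro has_vector_derivative_add)
  then show ?case using gaussian_span.add[OF v(1,3)] by (intro bexI allI)
qed

lemma gaussian_span_partial:
  assumes "u \<in> gaussian_span"
  shows "partial e u \<in> gaussian_span" "(\<lambda>t::real. u (x + t *\<^sub>R e)) differentiable (at 0)"
proof -
  obtain v where v: "v \<in> gaussian_span" "\<And>x. ((\<lambda>t. u (x + t *\<^sub>R e)) has_vector_derivative v x) (at 0)"
    using gaussian_span_derivative[OF assms, of e] by blast
  then have "partial e u = v" by (auto simp: partial_def vector_derivative_at)
  then show "partial e u \<in> gaussian_span" using v by simp
  show "(\<lambda>t::real. u (x + t *\<^sub>R e)) differentiable (at 0)"
    using v(2)[of x] by (rule differentiableI_vector)
qed

lemma gaussian_span_partials: "u \<in> gaussian_span \<Longrightarrow> partials es u \<in> gaussian_span"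
  by (induction es) (auto simp: partials_def gaussian_span_partial)

lemma gaussian_span_continuous: "u \<in> gaussian_span \<Longrightarrow> continuous_on UNIV u"
proof (induction rule: gaussian_span.induct)
  case (gaussian B)
  then have "bounded_bilinear B" by (simp add: bilinear_conv_bounded_bilinear)
  from bounded_bilinear.continuous_on[OF this continuous_on_id continuous_on_id]
  have "continuous_on UNIV (\<lambda>x. B x x)" .
  then show ?case by (intro continuous_intros)
qed (auto intro!: continuous_intros)

text \<open>
  Each coordinate factor costs one factor \<open>exp \<bar>x\<bar>\<close>, which the Gaussian absorbs.
\<close>

lemma gaussian_span_bound:
  "u \<in> gaussian_span \<Longrightarrow> \<exists>C m. C \<ge> 0 \<and> m \<ge> 0 \<and> (\<forall>x. cmod (u x) \<le> C * exp (m * norm x - (norm x)\<^sup>2))"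
proof (induction rule: gaussian_span.induct)
  case (gaussian B)
  then show ?case by (intro exI[of _ 1] exI[of _ 0]) (simp add: norm_exp_eq_Re)
next
  case (coord u e)
  then obtain C m where C: "C \<ge> 0" "m \<ge> 0" "\<And>x. cmod (u x) \<le> C * exp (m * norm x - (norm x)\<^sup>2)" by blast
  have "cmod (of_real (x \<bullet> e) * u x) \<le> norm e * C * exp ((m + 1) * norm x - (norm x)\<^sup>2)" for x
  proof -
    have "\<bar>x \<bullet> e\<bar> \<le> norm e * norm x" using Cauchy_Schwarz_ineq2[of x e] by (simp add: mult.commute)
    also have "\<dots> \<le> norm e * exp (norm x)"
    proof (rule mult_left_mono)
      show "norm x \<le> exp (norm x)" using exp_ge_add_one_self[of "norm x"] by linarith
    qed simp
    finally have "\<bar>x \<bullet> e\<bar> * cmod (u x) \<le> (norm e * exp (norm x)) * (C * exp (m * norm x - (norm x)\<^sup>2))"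
      using C by (intro mult_mono) auto
    also have "\<dots> = norm e * C * exp ((m + 1) * norm x - (norm x)\<^sup>2)"
      by (simp add: mult_exp_exp algebra_simps)
    finally show ?thesis by (simp add: norm_mult)
  qed
  then show ?case using C by (intro exI[of _ "norm e * C"] exI[of _ "m + 1"]) auto
next
  case (cmult u a)
  then obtain C m where C: "C \<ge> 0" "m \<ge> 0" "\<And>x. cmod (u x) \<le> C * exp (m * norm x - (norm x)\<^sup>2)" by blast
  then have "cmod (a * u x) \<le> cmod a * C * exp (m * norm x - (norm x)\<^sup>2)" for x
    by (simp add: norm_mult mult.assoc mult_left_mono)
  then show ?case using C by (intro exI[of _ "cmod a * C"] exI[of _ m]) auto
next
  case (add u v)
  then obtain C m D l where C: "C \<ge> 0" "m \<ge> 0" "\<And>x. cmod (u x) \<le> C * exp (m * norm x - (norm x)\<^sup>2)"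
    and D: "D \<ge> 0" "l \<ge> 0" "\<And>x. cmod (v x) \<le> D * exp (l * norm x - (norm x)\<^sup>2)" by metis
  have "cmod (u x + v x) \<le> (C + D) * exp (max m l * norm x - (norm x)\<^sup>2)" for x
  proof -
    have "C * exp (m * norm x - (norm x)\<^sup>2) \<le> C * exp (max m l * norm x - (norm x)\<^sup>2)"
      "D * exp (l * norm x - (norm x)\<^sup>2) \<le> D * exp (max m l * norm x - (norm x)\<^sup>2)"
      using C(1) D(1) by (auto intro!: mult_left_mono mult_right_mono)
    then show ?thesis
      using norm_triangle_ineq[of "u x" "v x"] C(3)[of x] D(3)[of x] by (simp add: distrib_right)
  qed
  then show ?case using C D by (intro exI[of _ "C + D"] exI[of _ "max m l"]) auto
qed

lemma gaussian_span_bounded: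
  assumes "u \<in> gaussian_span"
  shows "bounded (range u)"
proof -
  obtain C m where C: "C \<ge> 0" "\<And>x. cmod (u x) \<le> C * exp (m * norm x - (norm x)\<^sup>2)"
    using gaussian_span_bound[OF assms] by blast
  have "cmod (u x) \<le> C * exp (m\<^sup>2 / 4)" for x
  proof -
    have "m * norm x - (norm x)\<^sup>2 \<le> m\<^sup>2 / 4"
      using zero_le_power2[of "m / 2 - norm x"] by (simp add: power2_eq_square algebra_simps)
    then have "C * exp (m * norm x - (norm x)\<^sup>2) \<le> C * exp (m\<^sup>2 / 4)"
      using C(1) by (intro mult_left_mono) auto
    with C(2)[of x] show ?thesis by (rule order_trans)
  qed
  then show ?thesis unfolding bounded_iff by blast
qed

lemma gaussian_span_monomial:
  assumes u: "u \<in> gaussian_span"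
  shows "(\<lambda>x. (\<Prod>e\<in>A. (x \<bullet> e) ^ \<alpha> e) *\<^sub>R u x) \<in> gaussian_span"
proof (induction A rule: infinite_finite_induct)
  case (insert e A)
  have "(\<lambda>x. of_real ((x \<bullet> e) ^ n) * v x) \<in> gaussian_span" if "v \<in> gaussian_span" for n v
  proof (induction n)
    case (Suc n)
    from gaussian_span.coord[OF this, of e] show ?case by (simp add: mult.assoc)
  qed (use that in simp)
  from this[OF insert.IH, of "\<alpha> e"] insert.hyps show ?case by (simp add: scaleR_conv_of_real mult.assoc)
qed (use u in auto)

lemma gaussian_span_schwartz: "u \<in> gaussian_span \<Longrightarrow> u \<in> schwartz"
  unfolding schwartz_def smooth_def
  by (auto intro!: gaussian_span_continuous gaussian_span_partials gaussian_span_partial(2)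
      gaussian_span_bounded gaussian_span_monomial)

lemma exp_symbol_in_gaussian_span:
  fixes i j :: "'n::finite"
  shows "exp_symbol i j x y w \<in> gaussian_span"
proof -
  define B :: "complex^'n \<Rightarrow> complex^'n \<Rightarrow> real" where
    "B z v = x * (Re (z $ i * cnj (v $ i)) - Re (z $ j * cnj (v $ j)))
      + y * (2 * Im (cnj (z $ i) * v $ j)) + w * (2 * Re (cnj (z $ i) * v $ j))" for z v
  have "bilinear B"
    unfolding bilinear_def by (auto intro!: linearI simp: B_def algebra_simps)
  moreover have "B z z = x * coord_X i j z + y * coord_Y i j z + w * coord_Z i j z" for z
    unfolding B_def coord_X_def coord_Y_def coord_Z_def cmod_power2 by (simp add: power2_eq_square)
  ultimately show ?thesis
    using gaussian_span.gaussian[of B] unfolding exp_symbol_def[abs_def] by simp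
qed

section \<open>The two symbols\<close>

lemma exp_symbol_cis: "exp_symbol i j x y w z = of_real (exp (- (norm z)\<^sup>2)) * cis (x * coord_X i j z + y * coord_Y i j z + w * coord_Z i j z)"
  unfolding exp_symbol_def cis_conv_exp exp_of_real[symmetric] mult_exp_exp ..

lemma symbol_f_eq:
  "symbol_f i j = (\<lambda>z. exp_symbol i j 2 (-2) (-2) z + (-1) * exp_symbol i j (-2) (-2) 2 z
     + \<i> * exp_symbol i j 2 2 2 z + (-\<i>) * exp_symbol i j (-2) 2 (-2) z)"
proof (rule ext)
  fix z
  define X Y Z where "X = coord_X i j z" and "Y = coord_Y i j z" and "Z = coord_Z i j z"
  define E where "E = complex_of_real (exp (- (norm z)\<^sup>2))"
  have expand: "2 * E * (\<i> * cis (- a) * of_real (sin t) - cis a * of_real (sin s))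
      = E * (cis (- a) * cis t) + (-1) * (E * (cis (- a) * cis (- t)))
        + \<i> * (E * (cis a * cis s)) + (-\<i>) * (E * (cis a * cis (- s)))" for a s t
  proof -
    have "2 * (\<i> * cis (- a) * of_real (sin t) - cis a * of_real (sin s))
      = cis (- a) * cis t - cis (- a) * cis (- t) + \<i> * (cis a * cis s) - \<i> * (cis a * cis (- s))"
      by (simp add: complex_eq_iff algebra_simps)
    from arg_cong[OF this, of "\<lambda>c. E * c"] show ?thesis by (simp add: algebra_simps)
  qed
  have e: "exp (- 2 * \<i> * of_real Y) = cis (- (2 * Y))" "exp (2 * \<i> * of_real Y) = cis (2 * Y)"
    by (simp_all add: cis_conv_exp mult_ac)
  have c: "2 * X + - 2 * Y + - 2 * Z = - (2 * Y) + 2 * (X - Z)"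
    "- 2 * X + - 2 * Y + 2 * Z = - (2 * Y) + - (2 * (X - Z))"
    "2 * X + 2 * Y + 2 * Z = 2 * Y + 2 * (X + Z)"
    "- 2 * X + 2 * Y + - 2 * Z = 2 * Y + - (2 * (X + Z))"
    by simp_all
  show "symbol_f i j z = exp_symbol i j 2 (-2) (-2) z + (-1) * exp_symbol i j (-2) (-2) 2 z
     + \<i> * exp_symbol i j 2 2 2 z + (-\<i>) * exp_symbol i j (-2) 2 (-2) z"
    unfolding symbol_f_def Let_def exp_symbol_cis X_def[symmetric] Y_def[symmetric] Z_def[symmetric] E_def[symmetric]
      e c cis_mult[symmetric] by (rule expand)
qed

lemma symbol_g_eq:
  "symbol_g i j = (\<lambda>z. exp_symbol i j 2 (-2) 2 z + exp_symbol i j (-2) (-2) (-2) z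
     + \<i> * exp_symbol i j 2 2 (-2) z + \<i> * exp_symbol i j (-2) 2 2 z)"
proof (rule ext)
  fix z
  define X Y Z where "X = coord_X i j z" and "Y = coord_Y i j z" and "Z = coord_Z i j z"
  define E where "E = complex_of_real (exp (- (norm z)\<^sup>2))"
  have expand: "2 * E * (cis (- a) * of_real (cos s) + \<i> * cis a * of_real (cos t))
      = E * (cis (- a) * cis s) + E * (cis (- a) * cis (- s))
        + \<i> * (E * (cis a * cis t)) + \<i> * (E * (cis a * cis (- t)))" for a s t
  proof -
    have "2 * (cis (- a) * of_real (cos s) + \<i> * cis a * of_real (cos t))
      = cis (- a) * cis s + cis (- a) * cis (- s) + \<i> * (cis a * cis t) + \<i> * (cis a * cis (- t))"
      by (simp add: complex_eq_iff algebra_simps)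
    from arg_cong[OF this, of "\<lambda>c. E * c"] show ?thesis by (simp add: algebra_simps)
  qed
  have e: "exp (- 2 * \<i> * of_real Y) = cis (- (2 * Y))" "exp (2 * \<i> * of_real Y) = cis (2 * Y)"
    by (simp_all add: cis_conv_exp mult_ac)
  have c: "2 * X + - 2 * Y + 2 * Z = - (2 * Y) + 2 * (X + Z)"
    "- 2 * X + - 2 * Y + - 2 * Z = - (2 * Y) + - (2 * (X + Z))"
    "2 * X + 2 * Y + - 2 * Z = 2 * Y + 2 * (X - Z)"
    "- 2 * X + 2 * Y + 2 * Z = 2 * Y + - (2 * (X - Z))"
    by simp_all
  show "symbol_g i j z = exp_symbol i j 2 (-2) 2 z + exp_symbol i j (-2) (-2) (-2) z
     + \<i> * exp_symbol i j 2 2 (-2) z + \<i> * exp_symbol i j (-2) 2 2 z"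
    unfolding symbol_g_def Let_def exp_symbol_cis X_def[symmetric] Y_def[symmetric] Z_def[symmetric] E_def[symmetric]
      e c cis_mult[symmetric] by (rule expand)
qed

lemma symbols_schwartz: "symbol_f i j \<in> schwartz" "symbol_g i j \<in> schwartz"
  unfolding symbol_f_eq symbol_g_eq
  by (intro gaussian_span_schwartz gaussian_span.add gaussian_span.cmult exp_symbol_in_gaussian_span)+

lemma symbols_bound:
  "cmod (symbol_f i j z) \<le> 4 * exp (- (norm z)\<^sup>2)" "cmod (symbol_g i j z) \<le> 4 * exp (- (norm z)\<^sup>2)"
proof -
  let ?E = "2 * complex_of_real (exp (- (norm z)\<^sup>2))"
  have E: "cmod (?E * (a * of_real s + b * of_real t)) \<le> 4 * exp (- (norm z)\<^sup>2)"
    if "cmod a = 1" "cmod b = 1" "\<bar>s\<bar> \<le> 1" "\<bar>t\<bar> \<le> 1" for a b s t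
  proof -
    have "cmod (a * of_real s + b * of_real t) \<le> 1 + 1"
      by (rule norm_triangle_le) (use that in \<open>simp add: norm_mult\<close>)
    then show ?thesis by (simp add: norm_mult)
  qed
  show "cmod (symbol_f i j z) \<le> 4 * exp (- (norm z)\<^sup>2)"
    unfolding symbol_f_def Let_def
    using E[of "\<i> * exp (- 2 * \<i> * complex_of_real (coord_Y i j z))" "- exp (2 * \<i> * complex_of_real (coord_Y i j z))"]
    by (simp add: norm_mult norm_exp_eq_Re)
  show "cmod (symbol_g i j z) \<le> 4 * exp (- (norm z)\<^sup>2)"
    unfolding symbol_g_def Let_def
    using E[of "exp (- 2 * \<i> * complex_of_real (coord_Y i j z))" "\<i> * exp (2 * \<i> * complex_of_real (coord_Y i j z))"]
    by (simp add: norm_mult norm_exp_eq_Re)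
qed

text \<open>
  A radial function and its composition with an isometry agree almost everywhere, hence everywhere
  if they are continuous.
\<close>

lemma radial_isometry_invariant:
  fixes U :: "complex^'n \<Rightarrow> complex^'n"
  assumes r: "radial u" and u: "continuous_on UNIV u" and U: "linear U" "\<And>x. norm (U x) = norm x"
  shows "u (U z) = u z"
proof -
  obtain r where r: "AE z in lborel. u z = r (norm z)" using r by (auto simp: radial_def)
  then have "AE z in distr lborel borel U. u z = r (norm z)" by (subst distr_lborel_isometry[OF U(1) U(2)])
  then have "AE z in lborel. u (U z) = r (norm (U z))"
    using linear_borel_measurable[OF U(1)] by (intro AE_distrD[where M' = borel and f = U]) simp_all
  with r have "AE z in lborel. u (U z) - u z = 0" by eventually_elim (simp add: U)
  moreover have "continuous_on UNIV (\<lambda>z. u (U z) - u z)"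
  proof -
    have "continuous_on UNIV U" using U(1) by (simp add: linear_continuous_on linear_conv_bounded_linear)
    then have "continuous_on UNIV (\<lambda>z. u (U z))" by (rule continuous_on_compose2[OF u]) auto
    then show ?thesis using u by (rule continuous_on_diff)
  qed
  ultimately have "u (U z) - u z = 0" by (intro continuous_AE_zero)
  then show ?thesis by simp
qed

lemma sin_2_pos: "sin (2::real) > 0"
  using sin_gt_zero[of 2] pi_gt3 by simp

text \<open>
  The isometry moves the unit vector of coordinate \<open>i\<close> to that of coordinate \<open>j\<close>. This
  changes \<open>X = 1\<close> into \<open>X = -1\<close>, and \<open>f\<close> is odd in \<open>X\<close> when \<open>Y = Z = 0\<close>.
\<close>

lemma not_radial_symbol_f:
  assumes ij: "i \<noteq> j"
  shows "\<not> radial (symbol_f i j)"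
proof
  assume r: "radial (symbol_f i j)"
  have c: "continuous_on UNIV (symbol_f i j)"
    unfolding symbol_f_eq by (intro continuous_intros continuous_exp_symbol)
  define z :: "complex^'a" where "z = axis i 1"
  define U :: "complex^'a \<Rightarrow> complex^'a" where "U = quaternion_map i j 1 0 0 (-1) 0"
  have z: "z $ i = 1" "z $ j = 0" using ij by (simp_all add: z_def axis_def)
  have Uz: "U z $ i = 0" "U z $ j = 1"
    unfolding U_def quaternion_map_nth[OF ij] z by (simp_all add: complex_eq_iff)
  have n: "norm (U x) = norm x" for x unfolding U_def by (rule norm_quaternion_map_unit[OF ij]) simp
  have "symbol_f i j (U z) = symbol_f i j z"
    by (rule radial_isometry_invariant[OF r c _ n]) (simp add: U_def linear_quaternion_map)
  then show False
    using sin_2_pos unfolding symbol_f_def Let_def n coord_X_def coord_Y_def coord_Z_def z Uz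
    by (simp add: complex_eq_iff)
qed

text \<open>
  When \<open>Y = Z = 0\<close> the symbol \<open>g\<close> is even in \<open>X\<close>, so exchanging the two coordinates does
  not help; the isometry below moves \<open>(X, Y, Z) = (1, 0, 0)\<close> to \<open>(0, 1, 0)\<close> instead.
\<close>

lemma not_radial_symbol_g:
  assumes ij: "i \<noteq> j"
  shows "\<not> radial (symbol_g i j)"
proof
  assume r: "radial (symbol_g i j)"
  have c: "continuous_on UNIV (symbol_g i j)"
    unfolding symbol_g_eq by (intro continuous_intros continuous_exp_symbol)
  define s :: real where "s = sqrt (1 / 2)"
  have s: "s * s = 1 / 2" by (simp add: s_def)
  define z :: "complex^'a" where "z = axis i 1"
  define U :: "complex^'a \<Rightarrow> complex^'a" where "U = quaternion_map i j 1 s 0 0 s"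
  have z: "z $ i = 1" "z $ j = 0" using ij by (simp_all add: z_def axis_def)
  have Uz: "U z $ i = Complex s 0" "U z $ j = Complex 0 s"
    unfolding U_def quaternion_map_nth[OF ij] z by (simp_all add: complex_eq_iff)
  have n: "norm (U x) = norm x" for x
    unfolding U_def by (rule norm_quaternion_map_unit[OF ij]) (simp add: power2_eq_square s)
  have "symbol_g i j (U z) = symbol_g i j z"
    by (rule radial_isometry_invariant[OF r c _ n]) (simp add: U_def linear_quaternion_map)
  moreover have "coord_X i j (U z) = 0" "coord_Y i j (U z) = 1" "coord_Z i j (U z) = 0"
    unfolding coord_X_def coord_Y_def coord_Z_def Uz by (simp_all add: cmod_power2 s)
  moreover have "coord_X i j z = 1" "coord_Y i j z = 0" "coord_Z i j z = 0"
    unfolding coord_X_def coord_Y_def coord_Z_def z by simp_all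
  ultimately have "exp (- 2 * \<i>) + \<i> * exp (2 * \<i>) = of_real (cos 2) + \<i> * of_real (cos 2)"
    unfolding symbol_g_def Let_def n by simp
  then show False
    using sin_2_pos by (simp add: complex_eq_iff Re_exp Im_exp)
qed

section \<open>The zero product\<close>

text \<open>
  Here \<open>N = 16\<close>, and the quaternion is one quarter of a Hurwitz unit.
\<close>

lemma toeplitz_value_hurwitz:
  assumes "i \<noteq> j" "h \<in> fock_space" "x\<^sup>2 = 4" "y\<^sup>2 = 4" "w\<^sup>2 = 4"
  shows "toeplitz_value (exp_symbol i j x y w) h
    (\<lambda>z. exp_symbol_inverse_det i j (sqrt 12) * h (quaternion_map i j (1 / 2) (1 / 8) (x / 16) (y / 16) (w / 16) z))"
  using toeplitz_value_exp_symbol[OF assms(1,2), of 16 x y w] assms(3-5) by simp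

abbreviation hurwitz_map :: "'n \<Rightarrow> 'n \<Rightarrow> real \<Rightarrow> real \<Rightarrow> real \<Rightarrow> complex^'n \<Rightarrow> complex^'n" where
  "hurwitz_map i j a b c \<equiv> quaternion_map i j (1 / 2) (1 / 8) (a / 8) (b / 8) (c / 8)"

lemma toeplitz_value_symbol_f:
  assumes ij: "i \<noteq> j" and h: "h \<in> fock_space"
  shows "toeplitz_value (symbol_f i j) h (\<lambda>z. exp_symbol_inverse_det i j (sqrt 12) *
    (h (hurwitz_map i j 1 (-1) (-1) z) - h (hurwitz_map i j (-1) (-1) 1 z)
      + \<i> * h (hurwitz_map i j 1 1 1 z) - \<i> * h (hurwitz_map i j (-1) 1 (-1) z)))"
proof -
  note T = toeplitz_value_hurwitz[OF ij h]
  have "toeplitz_value (symbol_f i j) h (\<lambda>z. exp_symbol_inverse_det i j (sqrt 12) * h (quaternion_map i j (1 / 2) (1 / 8) (2 / 16) ((-2) / 16) ((-2) / 16) z)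
    + (-1) * (exp_symbol_inverse_det i j (sqrt 12) * h (quaternion_map i j (1 / 2) (1 / 8) ((-2) / 16) ((-2) / 16) (2 / 16) z))
    + \<i> * (exp_symbol_inverse_det i j (sqrt 12) * h (quaternion_map i j (1 / 2) (1 / 8) (2 / 16) (2 / 16) (2 / 16) z))
    + (-\<i>) * (exp_symbol_inverse_det i j (sqrt 12) * h (quaternion_map i j (1 / 2) (1 / 8) ((-2) / 16) (2 / 16) ((-2) / 16) z)))"
    unfolding symbol_f_eq by (intro toeplitz_value_add toeplitz_value_cmult T) simp_all
  then show ?thesis by (simp add: algebra_simps)
qed

lemma toeplitz_value_symbol_g:
  assumes ij: "i \<noteq> j" and h: "h \<in> fock_space"
  shows "toeplitz_value (symbol_g i j) h (\<lambda>z. exp_symbol_inverse_det i j (sqrt 12) *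
    (h (hurwitz_map i j 1 (-1) 1 z) + h (hurwitz_map i j (-1) (-1) (-1) z)
      + \<i> * h (hurwitz_map i j 1 1 (-1) z) + \<i> * h (hurwitz_map i j (-1) 1 1 z)))"
proof -
  note T = toeplitz_value_hurwitz[OF ij h]
  have "toeplitz_value (symbol_g i j) h (\<lambda>z. exp_symbol_inverse_det i j (sqrt 12) * h (quaternion_map i j (1 / 2) (1 / 8) (2 / 16) ((-2) / 16) (2 / 16) z)
    + exp_symbol_inverse_det i j (sqrt 12) * h (quaternion_map i j (1 / 2) (1 / 8) ((-2) / 16) ((-2) / 16) ((-2) / 16) z)
    + \<i> * (exp_symbol_inverse_det i j (sqrt 12) * h (quaternion_map i j (1 / 2) (1 / 8) (2 / 16) (2 / 16) ((-2) / 16) z))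
    + \<i> * (exp_symbol_inverse_det i j (sqrt 12) * h (quaternion_map i j (1 / 2) (1 / 8) ((-2) / 16) (2 / 16) (2 / 16) z)))"
    unfolding symbol_g_eq by (intro toeplitz_value_add toeplitz_value_cmult T) simp_all
  then show ?thesis by (simp add: algebra_simps)
qed

text \<open>
  The sixteen points at which \<open>h\<close> is evaluated are the images of \<open>z\<close> under products of two
  Hurwitz units, up to the common factor \<open>1 / 16\<close>. Only seven different products occur, and
  each of them has total coefficient zero.
\<close>

lemma toeplitz_f_toeplitz_g:
  assumes ij: "i \<noteq> j" and h: "h \<in> fock_space"
  shows "toeplitz (symbol_f i j) (toeplitz (symbol_g i j) h) = (\<lambda>z. 0)"
proof -
  note g = toeplitz_value_symbol_g[OF ij h]
  have gf: "toeplitz (symbol_g i j) h \<in> fock_space"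
    using g toeplitz_eq[OF g] by (simp add: toeplitz_value_def)
  show ?thesis
    unfolding toeplitz_eq[OF toeplitz_value_symbol_f[OF ij gf]] unfolding toeplitz_eq[OF g] quaternion_map_compose[OF ij]
    by (simp add: algebra_simps)
qed

lemma one_in_fock_space: "(\<lambda>_. 1) \<in> fock_space"
  by (rule fock_spaceI_growth[where C = 1 and a = 0 and m = 0]) (auto simp: entire_const)

lemma nth_in_fock_space: "(\<lambda>z::complex^'n. z $ k) \<in> fock_space"
proof (rule fock_spaceI_growth[where C = 1 and a = 0 and m = 1])
  fix z :: "complex^'n"
  have "cmod (z $ k) \<le> norm z" by (rule Finite_Cartesian_Product.norm_nth_le)
  also have "\<dots> \<le> exp (norm z)" using exp_ge_add_one_self[of "norm z"] by linarith
  finally show "cmod (z $ k) \<le> 1 * exp (0 * (norm z)\<^sup>2 + 1 * norm z)" by simp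
qed (auto simp: entire_nth)

text \<open>
  The coefficients of the four Hurwitz units in \<open>f\<close> add up to zero, so constants are
  annihilated. Weighted with the signs of their \<open>\<^bold>i\<close>-components they add up to \<open>2 + 2 \<i>\<close>,
  which \<open>z\<^sub>i\<close> detects at the unit vector of coordinate \<open>i\<close>.
\<close>

lemma toeplitz_f_nonzero:
  assumes ij: "i \<noteq> j"
  shows "\<exists>h\<in>fock_space. toeplitz (symbol_f i j) h \<noteq> (\<lambda>z. 0)"
proof (rule bexI[OF _ nth_in_fock_space[of i]], rule notI)
  assume "toeplitz (symbol_f i j) (\<lambda>z. z $ i) = (\<lambda>z. 0)"
  from fun_cong[OF this, of "axis i 1"] show False
    unfolding toeplitz_eq[OF toeplitz_value_symbol_f[OF ij nth_in_fock_space]] quaternion_map_nth[OF ij]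
    using ij exp_symbol_inverse_det_nonzero[of i j "sqrt 12"] by (simp add: axis_def complex_eq_iff)
qed

text \<open>
  The coefficients of the four Hurwitz units in \<open>g\<close> add up to \<open>2 + 2 \<i>\<close>.
\<close>

lemma toeplitz_g_nonzero:
  assumes ij: "i \<noteq> j"
  shows "\<exists>h\<in>fock_space. toeplitz (symbol_g i j) h \<noteq> (\<lambda>z. 0)"
proof (rule bexI[OF _ one_in_fock_space], rule notI)
  assume "toeplitz (symbol_g i j) (\<lambda>_. 1) = (\<lambda>z. 0)"
  from fun_cong[OF this, of 0] show False
    unfolding toeplitz_eq[OF toeplitz_value_symbol_g[OF ij one_in_fock_space]]
    using exp_symbol_inverse_det_nonzero[of i j "sqrt 12"] by (simp add: complex_eq_iff)
qed

theorem theorem1p1: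
  fixes i j :: "'n::finite"
  assumes "CARD('n) \<ge> 2" and "i \<noteq> j"
  shows "symbol_f i j \<in> schwartz \<and>
     symbol_g i j \<in> schwartz \<and>
     \<not> radial (symbol_f i j) \<and>
     \<not> radial (symbol_g i j) \<and>
     (\<forall>z. cmod (symbol_f i j z) \<le> 4 * exp (- (norm z)\<^sup>2)) \<and>
     (\<forall>z. cmod (symbol_g i j z) \<le> 4 * exp (- (norm z)\<^sup>2)) \<and>
     (\<forall>h\<in>fock_space. toeplitz (symbol_f i j) (toeplitz (symbol_g i j) h) = (\<lambda>z. 0)) \<and>
     (\<exists>h\<in>fock_space. toeplitz (symbol_f i j) h \<noteq> (\<lambda>z. 0)) \<and>
     (\<exists>h\<in>fock_space. toeplitz (symbol_g i j) h \<noteq> (\<lambda>z. 0))"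
  using symbols_schwartz symbols_bound not_radial_symbol_f[OF assms(2)] not_radial_symbol_g[OF assms(2)]
    toeplitz_f_toeplitz_g[OF assms(2)] toeplitz_f_nonzero[OF assms(2)] toeplitz_g_nonzero[OF assms(2)]
  by blast

end
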